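(* Let $X$ be a continuous vector field on $\mathbb{S}^1$. Then there exists a harmonic Lagrangian vector field on $\mathbb{H}^2$ which extends continuously to $X$ on $\mathbb{S}^1$.
   Context: Minkowski space $\mathbb{R}^{1,2}$ is $\mathbb{R}^3$ with $\langle x,y\rangle_{1,2}=-x_0y_0+x_1y_1+x_2y_2$. The hyperbolic plane is $\mathbb{H}^2=\{x\in\mathbb{R}^{1,2}: \langle x,x\rangle_{1,2}=-1,\ x_0>0\}$ with the induced Riemannian metric $g$, Levi-Civita connection $\nabla$ and complex structure $\mathrm{J}_p(v)=p\boxtimes v$, where $\langle x\boxtimes y,v\rangle_{1,2}=\det(x,y,v)$ for all $v$. Let $\mathbb{D}^2\subset\mathbb{R}^2$ be the open unit disk (Klein model), $\mathbb{S}^1=\partial\mathbb{D}^2$, and $\Pi:\mathbb{H}^2\to\mathbb{D}^2$, $\Pi(x_0,x_1,x_2)=(x_1/x_0,x_2/x_0)$. For $(x,v)\in \mathrm{T}\mathbb{H}^2$, identify $\mathrm{T}_x\mathbb{H}^2\times \mathrm{T}_x\mathbb{H}^2\cong \mathrm{T}_{(x,v)}\mathrm{T}\mathbb{H}^2$ by $(w_1,w_2)\mapsto w_1^{\mathcal{H}}+w_2^{\mathcal{V}}$ (horizontal lift of $w_1$ with respect to $\nabla$ plus vertical lift of $w_2$). Define $\mathbb{G}((X_1,X_2),(Y_1,Y_2))=g(X_1,Y_2)+g(X_2,Y_1)$ (a pseudo-Riemannian metric of signature $(2,2)$) and $\Omega((X_1,X_2),(Y_1,Y_2))=g(\mathrm{J}X_1,Y_2)-g(X_2,\mathrm{J}Y_1)$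 (a symplectic form). A smooth vector field $V:\mathbb{H}^2\to \mathrm{T}\mathbb{H}^2$ is harmonic Lagrangian if $V:(\mathbb{H}^2,g)\to(\mathrm{T}\mathbb{H}^2,\mathbb{G})$ is a harmonic map (its tension field $\mathrm{tr}_g(\nabla^2V)$, with $\nabla^2V(X,Y)=\nabla^{\mathbb{G}}_{\mathrm{d}V(X)}\mathrm{d}V(Y)-\mathrm{d}V(\nabla_XY)$, vanishes) and $V(\mathbb{H}^2)$ is Lagrangian for $\Omega$ ($V^*\Omega=0$). A continuous vector field $X$ on $\mathbb{S}^1$ is tangent to $\mathbb{S}^1$ and regarded as a map $\mathbb{S}^1\to\mathbb{R}^2$. A vector field $V$ on $\mathbb{H}^2$ extends continuously to $X$ if $\Pi_*V:\mathbb{D}^2\to\mathbb{R}^2$, $\Pi_*V(\eta)=\mathrm{d}_{\Pi^{-1}(\eta)}\Pi(V(\Pi^{-1}(\eta)))$, satisfies $\Pi_*V(\eta_n)\to X(\eta_\infty)$ whenever $\eta_n\in\mathbb{D}^2$ converges to $\eta_\infty\in\mathbb{S}^1$. *)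

theory Defs
  imports "HOL-Analysis.Analysis"
begin

section \<open>Smooth functions and connections on embedded submanifolds\<close>

text \<open>For open \<open>U\<close> in a Euclidean space, a function is of class \<open>C\<^sup>k\<^sup>+\<^sup>1\<close> iff it is differentiable and
  all of its directional derivatives are of class \<open>C\<^sup>k\<close>.\<close>

primrec Ck_on :: "nat \<Rightarrow> 'a::euclidean_space set \<Rightarrow> ('a \<Rightarrow> 'b::real_normed_vector) \<Rightarrow> bool" where
  "Ck_on 0 U f \<longleftrightarrow> continuous_on U f"
| "Ck_on (Suc k) U f \<longleftrightarrow>
     f differentiable_on U \<and> (\<forall>v. Ck_on k U (\<lambda>x. frechet_derivative f (at x) v))"

definition smooth_on :: "'a::euclidean_space set \<Rightarrow> ('a \<Rightarrow> 'b::real_normed_vector) \<Rightarrow> bool" where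
  "smooth_on M f \<longleftrightarrow>
     (\<exists>U g. open U \<and> M \<subseteq> U \<and> (\<forall>k. Ck_on k U g) \<and> (\<forall>x\<in>M. g x = f x))"

text \<open>The differential of a map defined on a submanifold \<open>M\<close>. The value is determined only for \<open>w\<close>
  tangent to \<open>M\<close> at \<open>x\<close>, and it is used only there.\<close>

abbreviation (input) diff_on ::
  "'a::euclidean_space set \<Rightarrow> ('a \<Rightarrow> 'b::real_normed_vector) \<Rightarrow> 'a \<Rightarrow> 'a \<Rightarrow> 'b" where
  "diff_on M f x w \<equiv> frechet_derivative f (at x within M) w"

definition vector_field ::
  "'a::euclidean_space set \<Rightarrow> ('a \<Rightarrow> 'a set) \<Rightarrow> ('a \<Rightarrow> 'a) \<Rightarrow> bool" where
  "vector_field M T X \<longleftrightarrow> smooth_on M X \<and> (\<forall>p\<in>M. X p \<in> T p)"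

text \<open>In the next two definitions \<open>M\<close> is a submanifold with tangent spaces \<open>T\<close>, and \<open>D Y p u\<close> is the
  covariant derivative of the vector field \<open>Y\<close> at the point \<open>p\<close> in the direction \<open>u\<close>. The bracket
  of vector fields appears as the commutator of the ambient directional derivatives.\<close>

definition affine_connection ::
  "'a::euclidean_space set \<Rightarrow> ('a \<Rightarrow> 'a set) \<Rightarrow> (('a \<Rightarrow> 'a) \<Rightarrow> 'a \<Rightarrow> 'a \<Rightarrow> 'a) \<Rightarrow> bool" where
  "affine_connection M T D \<longleftrightarrow>
     (\<forall>Y. vector_field M T Y \<longrightarrow> (\<forall>p\<in>M. \<forall>u\<in>T p. D Y p u \<in> T p)) \<and>
     (\<forall>X Y. vector_field M T X \<longrightarrow> vector_field M T Y \<longrightarrow> smooth_on M (\<lambda>p. D Y p (X p))) \<and>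
     (\<forall>Y. vector_field M T Y \<longrightarrow> (\<forall>p\<in>M. \<forall>u\<in>T p. \<forall>w\<in>T p. \<forall>a b.
        D Y p (a *\<^sub>R u + b *\<^sub>R w) = a *\<^sub>R D Y p u + b *\<^sub>R D Y p w)) \<and>
     (\<forall>Y Z. vector_field M T Y \<longrightarrow> vector_field M T Z \<longrightarrow> (\<forall>p\<in>M. \<forall>u\<in>T p.
        D (\<lambda>q. Y q + Z q) p u = D Y p u + D Z p u)) \<and>
     (\<forall>f Y. smooth_on M f \<longrightarrow> vector_field M T Y \<longrightarrow> (\<forall>p\<in>M. \<forall>u\<in>T p.
        D (\<lambda>q. f q *\<^sub>R Y q) p u = diff_on M f p u *\<^sub>R Y p + f p *\<^sub>R D Y p u))"

definition levi_civita ::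
  "'a::euclidean_space set \<Rightarrow> ('a \<Rightarrow> 'a set) \<Rightarrow> ('a \<Rightarrow> 'a \<Rightarrow> 'a \<Rightarrow> real) \<Rightarrow>
   (('a \<Rightarrow> 'a) \<Rightarrow> 'a \<Rightarrow> 'a \<Rightarrow> 'a) \<Rightarrow> bool" where
  "levi_civita M T g D \<longleftrightarrow>
     affine_connection M T D \<and>
     (\<forall>X Y. vector_field M T X \<longrightarrow> vector_field M T Y \<longrightarrow> (\<forall>p\<in>M.
        D Y p (X p) - D X p (Y p) = diff_on M Y p (X p) - diff_on M X p (Y p))) \<and>
     (\<forall>Y Z. vector_field M T Y \<longrightarrow> vector_field M T Z \<longrightarrow> (\<forall>p\<in>M. \<forall>u\<in>T p.
        diff_on M (\<lambda>q. g q (Y q) (Z q)) p u = g p (D Y p u) (Z p) + g p (Y p) (D Z p u)))"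


section \<open>The hyperbolic plane\<close>

text \<open>The coordinates \<open>x\<^sub>0, x\<^sub>1, x\<^sub>2\<close> of Minkowski space are \<open>x $ 1\<close>, \<open>x $ 2\<close>, \<open>x $ 3\<close>.\<close>

definition mink :: "real^3 \<Rightarrow> real^3 \<Rightarrow> real" where
  "mink x y = - (x $ 1 * y $ 1) + x $ 2 * y $ 2 + x $ 3 * y $ 3"

definition boxtimes :: "real^3 \<Rightarrow> real^3 \<Rightarrow> real^3" (infixl "\<boxtimes>" 70) where
  "x \<boxtimes> y = (THE z. \<forall>v. mink z v = det (vector [x, y, v] :: real^3^3))"

definition H2 :: "(real^3) set" where
  "H2 = {x. mink x x = -1 \<and> x $ 1 > 0}"

definition tangent_H2 :: "real^3 \<Rightarrow> (real^3) set" where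
  "tangent_H2 x = {w. mink x w = 0}"

definition J :: "real^3 \<Rightarrow> real^3 \<Rightarrow> real^3" where
  "J p v = p \<boxtimes> v"

text \<open>The Levi-Civita connection of the induced metric is the tangential part of the flat
  connection of Minkowski space; see \<open>levi_civita_nabla\<close> below.\<close>

definition nabla :: "(real^3 \<Rightarrow> real^3) \<Rightarrow> real^3 \<Rightarrow> real^3 \<Rightarrow> real^3" where
  "nabla Y x w = diff_on H2 Y x w + mink x (diff_on H2 Y x w) *\<^sub>R x"


section \<open>The tangent bundle of the hyperbolic plane\<close>

definition TH2 :: "((real^3) \<times> (real^3)) set" where
  "TH2 = {(x, v). x \<in> H2 \<and> v \<in> tangent_H2 x}"

text \<open>Along a curve through \<open>x\<close> with velocity \<open>w\<close>, the \<open>\<nabla>\<close>-parallel vector field with initial value \<open>v\<close>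
  has derivative normal to \<open>H2\<close>, that is a multiple of \<open>x\<close>; differentiating \<open>\<langle>x, v\<rangle> = 0\<close> shows that
  the factor is \<open>\<langle>w, v\<rangle>\<close>. See also \<open>diff_graph_eq_lifts\<close> below.\<close>

definition hlift :: "(real^3) \<times> (real^3) \<Rightarrow> real^3 \<Rightarrow> (real^3) \<times> (real^3)" where
  "hlift p w = (w, mink w (snd p) *\<^sub>R fst p)"

definition vlift :: "(real^3) \<times> (real^3) \<Rightarrow> real^3 \<Rightarrow> (real^3) \<times> (real^3)" where
  "vlift p w = (0, w)"

definition tangent_TH2 :: "(real^3) \<times> (real^3) \<Rightarrow> ((real^3) \<times> (real^3)) set" where
  "tangent_TH2 p = {hlift p w1 + vlift p w2 | w1 w2. w1 \<in> tangent_H2 (fst p) \<and> w2 \<in> tangent_H2 (fst p)}"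

text \<open>The components \<open>(w\<^sub>1, w\<^sub>2)\<close> of \<open>\<xi> = hlift p w\<^sub>1 + vlift p w\<^sub>2\<close>.\<close>

definition hpart :: "(real^3) \<times> (real^3) \<Rightarrow> (real^3) \<times> (real^3) \<Rightarrow> real^3" where
  "hpart p \<xi> = fst \<xi>"

definition vpart :: "(real^3) \<times> (real^3) \<Rightarrow> (real^3) \<times> (real^3) \<Rightarrow> real^3" where
  "vpart p \<xi> = snd (\<xi> - hlift p (fst \<xi>))"

definition GG :: "(real^3) \<times> (real^3) \<Rightarrow> (real^3) \<times> (real^3) \<Rightarrow> (real^3) \<times> (real^3) \<Rightarrow> real" where
  "GG p \<xi> \<zeta> = mink (hpart p \<xi>) (vpart p \<zeta>) + mink (vpart p \<xi>) (hpart p \<zeta>)"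

definition Omega :: "(real^3) \<times> (real^3) \<Rightarrow> (real^3) \<times> (real^3) \<Rightarrow> (real^3) \<times> (real^3) \<Rightarrow> real" where
  "Omega p \<xi> \<zeta> =
     mink (J (fst p) (hpart p \<xi>)) (vpart p \<zeta>) - mink (vpart p \<xi>) (J (fst p) (hpart p \<zeta>))"


section \<open>Harmonic Lagrangian vector fields\<close>

text \<open>A vector field \<open>V\<close>, as a map from \<open>H2\<close> to the total space \<open>TH2\<close>.\<close>

definition graph_map :: "(real^3 \<Rightarrow> real^3) \<Rightarrow> real^3 \<Rightarrow> (real^3) \<times> (real^3)" where
  "graph_map V x = (x, V x)"

text \<open>\<open>Z\<close> is a vector field on \<open>TH2\<close> extending the section \<open>dV(Y)\<close> along \<open>V\<close>. Such an extension always
  exists: at \<open>(x, v)\<close> take the horizontal lift of \<open>Y x\<close> plus the vertical lift of \<open>nabla V x (Y x)\<close>.\<close>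

definition extends_differential ::
  "(real^3 \<Rightarrow> real^3) \<Rightarrow> (real^3 \<Rightarrow> real^3) \<Rightarrow> ((real^3) \<times> (real^3) \<Rightarrow> (real^3) \<times> (real^3)) \<Rightarrow> bool" where
  "extends_differential V Y Z \<longleftrightarrow>
     vector_field TH2 tangent_TH2 Z \<and>
     (\<forall>x\<in>H2. Z (graph_map V x) = diff_on H2 (graph_map V) x (Y x))"

text \<open>\<open>\<nabla>\<^sup>2V(X, Y)\<close> at \<open>x\<close>, where \<open>D\<close> is the Levi-Civita connection of \<open>GG\<close> and \<open>Z\<close> extends \<open>dV(Y)\<close>:
  the covariant derivative of \<open>dV(Y)\<close> along \<open>V\<close> is \<open>D Z\<close> in the direction \<open>dV(X)\<close>.\<close>

definition hessian_map ::
  "(((real^3) \<times> (real^3) \<Rightarrow> (real^3) \<times> (real^3)) \<Rightarrow>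
      (real^3) \<times> (real^3) \<Rightarrow> (real^3) \<times> (real^3) \<Rightarrow> (real^3) \<times> (real^3)) \<Rightarrow>
   (real^3 \<Rightarrow> real^3) \<Rightarrow> (real^3 \<Rightarrow> real^3) \<Rightarrow> (real^3 \<Rightarrow> real^3) \<Rightarrow>
   ((real^3) \<times> (real^3) \<Rightarrow> (real^3) \<times> (real^3)) \<Rightarrow> real^3 \<Rightarrow> (real^3) \<times> (real^3)" where
  "hessian_map D V X Y Z x =
     D Z (graph_map V x) (diff_on H2 (graph_map V) x (X x)) -
     diff_on H2 (graph_map V) x (nabla Y x (X x))"

text \<open>The connection \<open>D\<close> is unique, see \<open>levi_civita_GG_unique\<close> below. The trace at \<open>x\<close> is computed with
  vector fields that form an orthonormal basis of the tangent space at \<open>x\<close>.\<close>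

definition harmonic_field :: "(real^3 \<Rightarrow> real^3) \<Rightarrow> bool" where
  "harmonic_field V \<longleftrightarrow>
     (\<exists>D. levi_civita TH2 tangent_TH2 GG D \<and>
       (\<forall>x\<in>H2. \<forall>E\<^sub>1 E\<^sub>2 Z\<^sub>1 Z\<^sub>2.
          vector_field H2 tangent_H2 E\<^sub>1 \<longrightarrow> vector_field H2 tangent_H2 E\<^sub>2 \<longrightarrow>
          mink (E\<^sub>1 x) (E\<^sub>1 x) = 1 \<longrightarrow> mink (E\<^sub>2 x) (E\<^sub>2 x) = 1 \<longrightarrow> mink (E\<^sub>1 x) (E\<^sub>2 x) = 0 \<longrightarrow>
          extends_differential V E\<^sub>1 Z\<^sub>1 \<longrightarrow> extends_differential V E\<^sub>2 Z\<^sub>2 \<longrightarrow>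
          hessian_map D V E\<^sub>1 E\<^sub>1 Z\<^sub>1 x + hessian_map D V E\<^sub>2 E\<^sub>2 Z\<^sub>2 x = 0))"

definition lagrangian_field :: "(real^3 \<Rightarrow> real^3) \<Rightarrow> bool" where
  "lagrangian_field V \<longleftrightarrow>
     (\<forall>x\<in>H2. \<forall>w1\<in>tangent_H2 x. \<forall>w2\<in>tangent_H2 x.
        Omega (graph_map V x) (diff_on H2 (graph_map V) x w1) (diff_on H2 (graph_map V) x w2) = 0)"

definition harmonic_lagrangian :: "(real^3 \<Rightarrow> real^3) \<Rightarrow> bool" where
  "harmonic_lagrangian V \<longleftrightarrow>
     vector_field H2 tangent_H2 V \<and> harmonic_field V \<and> lagrangian_field V"


section \<open>Extension to the boundary circle in the Klein model\<close>

definition Klein :: "real^3 \<Rightarrow> real^2" where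
  "Klein x = vector [x $ 2 / x $ 1, x $ 3 / x $ 1]"

definition Klein_inv :: "real^2 \<Rightarrow> real^3" where
  "Klein_inv = inv_into H2 Klein"

definition Klein_push :: "(real^3 \<Rightarrow> real^3) \<Rightarrow> real^2 \<Rightarrow> real^2" where
  "Klein_push V \<eta> = diff_on H2 Klein (Klein_inv \<eta>) (V (Klein_inv \<eta>))"

definition continuous_circle_field :: "(real^2 \<Rightarrow> real^2) \<Rightarrow> bool" where
  "continuous_circle_field X \<longleftrightarrow>
     continuous_on (sphere 0 1) X \<and> (\<forall>z\<in>sphere 0 1. X z \<bullet> z = 0)"

definition extends_continuously_to :: "(real^3 \<Rightarrow> real^3) \<Rightarrow> (real^2 \<Rightarrow> real^2) \<Rightarrow> bool" where
  "extends_continuously_to V X \<longleftrightarrow>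
     (\<forall>\<eta> z. (\<forall>n. \<eta> n \<in> ball 0 1) \<longrightarrow> z \<in> sphere 0 1 \<longrightarrow> \<eta> \<longlonglongrightarrow> z \<longrightarrow>
        (\<lambda>n. Klein_push V (\<eta> n)) \<longlonglongrightarrow> X z)"


section \<open>Consistency of the definitions\<close>

lemma mink_nondegenerate:
  assumes "\<And>v. mink z v = mink z' v"
  shows "z = z'"
proof -
  have "z $ 1 = z' $ 1" using assms[of "vector [1,0,0]"] by (simp add: mink_def)
  moreover have "z $ 2 = z' $ 2" using assms[of "vector [0,1,0]"] by (simp add: mink_def)
  moreover have "z $ 3 = z' $ 3" using assms[of "vector [0,0,1]"] by (simp add: mink_def)
  ultimately show ?thesis by (simp add: vec_eq_iff forall_3)
qed

lemma boxtimes_explicit: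
  "x \<boxtimes> y = vector [x $ 3 * y $ 2 - x $ 2 * y $ 3,
                   x $ 3 * y $ 1 - x $ 1 * y $ 3,
                   x $ 1 * y $ 2 - x $ 2 * y $ 1]" (is "_ = ?z")
  unfolding boxtimes_def
proof (rule the_equality)
  show *: "\<forall>v. mink ?z v = det (vector [x, y, v] :: real^3^3)"
    by (simp add: mink_def det_3 algebra_simps)
  show "z = ?z" if "\<forall>v. mink z v = det (vector [x, y, v] :: real^3^3)" for z
    using that * by (intro mink_nondegenerate) simp
qed

lemma mink_boxtimes: "mink (x \<boxtimes> y) v = det (vector [x, y, v] :: real^3^3)"
  by (simp add: boxtimes_explicit mink_def det_3 algebra_simps)

lemma Ck_on_cong:
  assumes "open U" "\<And>x. x \<in> U \<Longrightarrow> f x = g x" "Ck_on k U f"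
  shows "Ck_on k U g"
  using assms(2,3)
proof (induction k arbitrary: f g)
  case 0
  then show ?case by (simp cong: continuous_on_cong)
next
  case (Suc k)
  have d: "frechet_derivative f (at x) = frechet_derivative g (at x)"
    "g differentiable (at x)" if "x \<in> U" for x
  proof -
    have "f differentiable (at x)"
      using Suc.prems(2) that \<open>open U\<close> by (auto simp: differentiable_on_eq_differentiable_at)
    then have "(f has_derivative frechet_derivative f (at x)) (at x)"
      by (simp add: frechet_derivative_works)
    then have "(g has_derivative frechet_derivative f (at x)) (at x)"
      using has_derivative_transform_within_open[OF _ \<open>open U\<close> that] Suc.prems(1) by blast
    then show "frechet_derivative f (at x) = frechet_derivative g (at x)"
      "g differentiable (at x)"
      by (auto simp: frechet_derivative_at differentiable_def)
  qed
  then show ?case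
    using Suc.prems(2) Suc.IH[of "\<lambda>x. frechet_derivative f (at x) v" "\<lambda>x. frechet_derivative g (at x) v" for v]
      \<open>open U\<close>
    by (auto simp: differentiable_on_eq_differentiable_at)
qed

lemma Ck_on_Suc_imp: "open U \<Longrightarrow> Ck_on (Suc k) U f \<Longrightarrow> Ck_on k U f"
proof (induction k arbitrary: f)
  case 0
  then show ?case by (auto intro: differentiable_imp_continuous_on)
next
  case (Suc k)
  then show ?case by (subst Ck_on.simps) (auto simp del: Ck_on.simps simp: Ck_on.simps(2)[of "Suc k"])
qed

lemma Ck_on_subset: "open U \<Longrightarrow> open W \<Longrightarrow> W \<subseteq> U \<Longrightarrow> Ck_on k U f \<Longrightarrow> Ck_on k W f"
  by (induction k arbitrary: f) (auto intro: continuous_on_subset differentiable_on_subset)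

lemma Ck_on_const: "open U \<Longrightarrow> Ck_on k U (\<lambda>x. c)"
  by (induction k arbitrary: c) auto

lemma Ck_on_linear:
  assumes "open U" "bounded_linear h" "Ck_on k U f"
  shows "Ck_on k U (\<lambda>x. h (f x))"
  using assms(3)
proof (induction k arbitrary: f)
  case 0
  then show ?case
    using assms(2) by (auto intro: bounded_linear.continuous_on)
next
  case (Suc k)
  have d: "((\<lambda>x. h (f x)) has_derivative (\<lambda>v. h (frechet_derivative f (at x) v))) (at x)"
    if "x \<in> U" for x
    using Suc.prems that assms(1,2)
    by (auto simp: differentiable_on_eq_differentiable_at frechet_derivative_works
        intro: bounded_linear.has_derivative)
  have "Ck_on k U (\<lambda>x. frechet_derivative (\<lambda>x. h (f x)) (at x) v)" for v
    by (rule Ck_on_cong[OF assms(1) _ Suc.IH[of "\<lambda>x. frechet_derivative f (at x) v"]])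
      (use Suc.prems in \<open>auto simp: frechet_derivative_at[OF d, symmetric]\<close>)
  with d show ?case
    using assms(1) by (auto simp: differentiable_on_eq_differentiable_at differentiable_def)
qed

lemma Ck_on_add:
  assumes "open U" "Ck_on k U f" "Ck_on k U g"
  shows "Ck_on k U (\<lambda>x. f x + g x)"
  using assms(2,3)
proof (induction k arbitrary: f g)
  case 0
  then show ?case by (auto intro: continuous_on_add)
next
  case (Suc k)
  have d: "((\<lambda>x. f x + g x) has_derivative
      (\<lambda>v. frechet_derivative f (at x) v + frechet_derivative g (at x) v)) (at x)" if "x \<in> U" for x
    using Suc.prems that assms(1)
    by (auto simp: differentiable_on_eq_differentiable_at frechet_derivative_works
        intro: has_derivative_add)
  have "Ck_on k U (\<lambda>x. frechet_derivative (\<lambda>x. f x + g x) (at x) v)" for v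
    by (rule Ck_on_cong[OF assms(1) _ Suc.IH[of "\<lambda>x. frechet_derivative f (at x) v"
            "\<lambda>x. frechet_derivative g (at x) v"]])
      (use Suc.prems in \<open>auto simp: frechet_derivative_at[OF d, symmetric]\<close>)
  with d show ?case
    using assms(1) by (auto simp: differentiable_on_eq_differentiable_at differentiable_def)
qed

lemma Ck_on_sum:
  assumes "open U" "\<And>i. i \<in> I \<Longrightarrow> Ck_on k U (f i)"
  shows "Ck_on k U (\<lambda>x. \<Sum>i\<in>I. f i x)"
  using assms(2)
  by (induction I rule: infinite_finite_induct) (auto intro: Ck_on_add Ck_on_const assms(1))

lemma Ck_on_bilinear:
  assumes "open U" "bounded_bilinear h" "Ck_on k U f" "Ck_on k U g"
  shows "Ck_on k U (\<lambda>x. h (f x) (g x))"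
  using assms(3,4)
proof (induction k arbitrary: f g)
  case 0
  then show ?case by (auto intro: bounded_bilinear.continuous_on[OF assms(2)])
next
  case (Suc k)
  have d: "((\<lambda>x. h (f x) (g x)) has_derivative
      (\<lambda>v. h (f x) (frechet_derivative g (at x) v) + h (frechet_derivative f (at x) v) (g x))) (at x)"
    if "x \<in> U" for x
    using Suc.prems that assms(1)
    by (auto simp: differentiable_on_eq_differentiable_at frechet_derivative_works
        intro: bounded_bilinear.FDERIV[OF assms(2)])
  have "Ck_on k U (\<lambda>x. frechet_derivative (\<lambda>x. h (f x) (g x)) (at x) v)" for v
  proof (rule Ck_on_cong[OF assms(1)])
    show "Ck_on k U (\<lambda>x. h (f x) (frechet_derivative g (at x) v) + h (frechet_derivative f (at x) v) (g x))"
      using Suc.prems Ck_on_Suc_imp[OF assms(1) Suc.prems(1)] Ck_on_Suc_imp[OF assms(1) Suc.prems(2)]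
      by (intro Ck_on_add assms(1) Suc.IH) auto
  qed (simp add: frechet_derivative_at[OF d, symmetric])
  with d show ?case
    using assms(1) by (auto simp: differentiable_on_eq_differentiable_at differentiable_def)
qed

lemma Ck_on_id: "open U \<Longrightarrow> Ck_on k U (\<lambda>x. x)"
  by (cases k) (auto intro: Ck_on_const)

lemma Ck_on_derivative:
  assumes "open U" "\<And>k. Ck_on k U f" "\<And>k. Ck_on k U g"
  shows "Ck_on k U (\<lambda>x. frechet_derivative f (at x) (g x))"
proof (rule Ck_on_cong[OF assms(1)])
  show "Ck_on k U (\<lambda>x. \<Sum>b\<in>Basis. (g x \<bullet> b) *\<^sub>R frechet_derivative f (at x) b)"
    using assms(2)[of "Suc k"] assms(1,3)
    by (intro Ck_on_sum Ck_on_bilinear[OF _ bounded_bilinear_scaleR]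
        Ck_on_linear[OF _ bounded_linear_inner_left]) auto
  fix x assume "x \<in> U"
  then have "f differentiable (at x)"
    using assms(2)[of "Suc 0"] assms(1) by (auto simp: differentiable_on_eq_differentiable_at)
  then have "linear (frechet_derivative f (at x))"
    using linear_frechet_derivative by blast
  then show "(\<Sum>b\<in>Basis. (g x \<bullet> b) *\<^sub>R frechet_derivative f (at x) b) = frechet_derivative f (at x) (g x)"
    by (subst (2) euclidean_representation[of "g x", symmetric]) (simp add: linear_sum linear_cmul)
qed

lemma smooth_onE2:
  assumes "smooth_on M f" "smooth_on M g"
  obtains U f' g' where "open U" "M \<subseteq> U" "\<And>k. Ck_on k U f'" "\<And>k. Ck_on k U g'"
    "\<And>x. x \<in> M \<Longrightarrow> f' x = f x" "\<And>x. x \<in> M \<Longrightarrow> g' x = g x"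
proof -
  obtain U f' where f: "open U" "M \<subseteq> U" "\<And>k. Ck_on k U f'" "\<And>x. x \<in> M \<Longrightarrow> f' x = f x"
    using assms(1) unfolding smooth_on_def by blast
  obtain W g' where g: "open W" "M \<subseteq> W" "\<And>k. Ck_on k W g'" "\<And>x. x \<in> M \<Longrightarrow> g' x = g x"
    using assms(2) unfolding smooth_on_def by blast
  show thesis
    by (rule that[of "U \<inter> W" f' g'])
      (use f g in \<open>auto intro: Ck_on_subset[OF f(1) _ _ f(3)] Ck_on_subset[OF g(1) _ _ g(3)]\<close>)
qed

lemma smooth_on_imp_has_derivative:
  assumes "open U" "M \<subseteq> U" "Ck_on (Suc k) U f'" "\<And>x. x \<in> M \<Longrightarrow> f' x = f x" "x \<in> M"
  shows "(f has_derivative frechet_derivative f' (at x)) (at x within M)"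
proof -
  have "f' differentiable (at x)"
    using assms by (auto simp: differentiable_on_eq_differentiable_at)
  then have "(f' has_derivative frechet_derivative f' (at x)) (at x within M)"
    using frechet_derivative_works has_derivative_at_withinI by blast
  then show ?thesis
    by (rule has_derivative_transform[OF assms(5), rotated]) (use assms(4) in auto)
qed

lemma smooth_on_differentiable:
  assumes "smooth_on M f" "x \<in> M"
  shows "(f has_derivative diff_on M f x) (at x within M)"
proof -
  obtain U f' where "open U" "M \<subseteq> U" "\<And>k. Ck_on k U f'" "\<And>x. x \<in> M \<Longrightarrow> f' x = f x"
    using assms(1) unfolding smooth_on_def by blast
  from smooth_on_imp_has_derivative[OF this(1,2) this(3)[of "Suc 0"] this(4) assms(2)]
  show ?thesis using frechet_derivative_works differentiable_def by blast
qed

lemma mink_bounded_bilinear: "bounded_bilinear mink"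
proof -
  define R :: "real^3 \<Rightarrow> real^3" where "R x = vector [- x $ 1, x $ 2, x $ 3]" for x
  have "linear R"
    by (rule linearI) (simp_all add: R_def vec_eq_iff forall_3)
  then have "bounded_bilinear (\<lambda>x. inner (R x))"
    by (intro bounded_bilinear.comp1[OF bounded_bilinear_inner])
      (simp add: linear_conv_bounded_linear)
  moreover have "(\<lambda>x. inner (R x)) = mink"
    by (auto simp: R_def mink_def inner_vec_def sum_3 fun_eq_iff)
  ultimately show ?thesis by simp
qed

lemma mink_simps:
  "mink (x + y) z = mink x z + mink y z" "mink x (y + z) = mink x y + mink x z"
  "mink (x - y) z = mink x z - mink y z" "mink x (y - z) = mink x y - mink x z"
  "mink (a *\<^sub>R x) z = a * mink x z" "mink x (a *\<^sub>R z) = a * mink x z"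
  by (simp_all add: mink_def algebra_simps)

lemma mink_commute: "mink x y = mink y x"
  by (simp add: mink_def mult.commute)

lemma H2_has_derivative_unique:
  assumes x: "x \<in> H2" and w: "w \<in> tangent_H2 x"
    and f: "(f has_derivative f') (at x within H2)" "(f has_derivative f'') (at x within H2)"
  shows "f' w = f'' w"
proof -
  define r where "r t = 1 + (x $ 2 + t * w $ 2)\<^sup>2 + (x $ 3 + t * w $ 3)\<^sup>2" for t
  define c :: "real \<Rightarrow> real^3" where
    "c t = sqrt (r t) *\<^sub>R axis 1 1 + (x $ 2 + t * w $ 2) *\<^sub>R axis 2 1 + (x $ 3 + t * w $ 3) *\<^sub>R axis 3 1" for t
  have c: "c t $ 1 = sqrt (r t)" "c t $ 2 = x $ 2 + t * w $ 2" "c t $ 3 = x $ 3 + t * w $ 3" for t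
    by (simp_all add: c_def axis_def)
  have r: "r t > 0" for t
    unfolding r_def by (smt (verit) zero_le_power2)
  have cH: "c t \<in> H2" for t
    using r[of t] by (simp add: H2_def mink_def c) (simp add: r_def power2_eq_square)
  have x1: "x $ 1 > 0" "(x $ 1)\<^sup>2 = r 0"
    using x by (auto simp: H2_def mink_def r_def power2_eq_square)
  then have sq: "sqrt (r 0) = x $ 1"
    by (metis less_eq_real_def real_sqrt_unique)
  have c0: "c 0 = x"
    using sq by (simp add: vec_eq_iff forall_3 c)
  have tw: "x $ 2 * w $ 2 + x $ 3 * w $ 3 = x $ 1 * w $ 1"
    using w by (simp add: tangent_H2_def mink_def)
  have "(r has_real_derivative 2 * (x $ 2 * w $ 2 + x $ 3 * w $ 3)) (at 0)"
    unfolding r_def by (auto intro!: derivative_eq_intros)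
  then have "((\<lambda>t. sqrt (r t)) has_real_derivative
      inverse (sqrt (r 0)) / 2 * (2 * (x $ 2 * w $ 2 + x $ 3 * w $ 3))) (at 0)"
    by (rule DERIV_chain2[where f = sqrt and g = r, OF DERIV_real_sqrt[OF r[of 0]]])
  then have "((\<lambda>t. sqrt (r t)) has_real_derivative w $ 1) (at 0)"
    unfolding sq tw using x1(1) by (simp add: mult.assoc[symmetric])
  moreover have "(*) (w $ 1) = (\<lambda>t. t * w $ 1)"
    by (simp add: fun_eq_iff)
  ultimately have "((\<lambda>t. sqrt (r t)) has_derivative (\<lambda>t. t * w $ 1)) (at 0)"
    unfolding has_field_derivative_def by simp
  then have "(c has_derivative (\<lambda>t. (t * w $ 1) *\<^sub>R axis 1 1 + (t * w $ 2) *\<^sub>R axis 2 1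
      + (t * w $ 3) *\<^sub>R axis 3 1)) (at 0)"
    unfolding c_def
    by (intro has_derivative_add bounded_linear.has_derivative[OF bounded_linear_scaleR_left])
      (auto intro!: derivative_eq_intros)
  moreover have "(\<lambda>t. (t * w $ 1) *\<^sub>R axis 1 1 + (t * w $ 2) *\<^sub>R axis 2 1
      + (t * w $ 3) *\<^sub>R axis 3 1) = (\<lambda>t. t *\<^sub>R w)"
    by (auto simp: fun_eq_iff vec_eq_iff forall_3 axis_def)
  ultimately have dc: "(c has_derivative (\<lambda>t. t *\<^sub>R w)) (at 0)" by simp
  have "(f \<circ> c has_derivative h \<circ> (\<lambda>t. t *\<^sub>R w)) (at 0)" if "(f has_derivative h) (at x within H2)" for h
    using diff_chain_within[OF dc, of f h] has_derivative_subset[OF that, of "range c"] cH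
    by (auto simp: c0)
  from has_derivative_unique[OF this[OF f(1)] this[OF f(2)]]
  have "(f' \<circ> (\<lambda>t. t *\<^sub>R w)) 1 = (f'' \<circ> (\<lambda>t. t *\<^sub>R w)) 1" by (rule fun_cong)
  then show ?thesis by simp
qed

lemma H2_diff_onI:
  assumes "x \<in> H2" "w \<in> tangent_H2 x" "(f has_derivative f') (at x within H2)"
  shows "diff_on H2 f x w = f' w"
proof -
  have "(f has_derivative diff_on H2 f x) (at x within H2)"
    using assms(3) frechet_derivative_works differentiable_def by blast
  from H2_has_derivative_unique[OF assms(1,2) this assms(3)] show ?thesis .
qed

lemma mink_diff_field:
  assumes Y: "vector_field H2 tangent_H2 Y" and x: "x \<in> H2" and w: "w \<in> tangent_H2 x"
  shows "mink x (diff_on H2 Y x w) = - mink w (Y x)"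
proof -
  have "(Y has_derivative diff_on H2 Y x) (at x within H2)"
    using Y x smooth_on_differentiable unfolding vector_field_def by blast
  then have "((\<lambda>x. mink x (Y x)) has_derivative (\<lambda>w. mink x (diff_on H2 Y x w) + mink w (Y x))) (at x within H2)"
    by (intro bounded_bilinear.FDERIV[OF mink_bounded_bilinear]) auto
  moreover have "((\<lambda>x. mink x (Y x)) has_derivative (\<lambda>w. 0)) (at x within H2)"
    by (rule has_derivative_transform[OF x, of _ "\<lambda>x. 0"])
      (use Y in \<open>auto simp: vector_field_def tangent_H2_def\<close>)
  ultimately show ?thesis
    using H2_has_derivative_unique[OF x w, of "\<lambda>x. mink x (Y x)"
        "\<lambda>w. mink x (diff_on H2 Y x w) + mink w (Y x)" "\<lambda>w. 0"] by simp
qed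

lemma levi_civita_nabla: "levi_civita H2 tangent_H2 (\<lambda>_. mink) nabla"
proof -
  let ?vf = "vector_field H2 tangent_H2"
  have d: "(Y has_derivative diff_on H2 Y x) (at x within H2)" if "?vf Y" "x \<in> H2" for Y x
    using that smooth_on_differentiable unfolding vector_field_def by blast
  have nab: "nabla Y x w = diff_on H2 Y x w - mink w (Y x) *\<^sub>R x"
    if "?vf Y" "x \<in> H2" "w \<in> tangent_H2 x" for Y x w
    using mink_diff_field[OF that] by (simp add: nabla_def)
  have 1: "nabla Y x w \<in> tangent_H2 x" if "x \<in> H2" for Y x w
    using that by (simp add: nabla_def tangent_H2_def mink_simps H2_def)
  have 2: "smooth_on H2 (\<lambda>x. nabla Y x (X x))" if X: "?vf X" and Y: "?vf Y" for X Y
  proof -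
    obtain U X' Y' where U: "open U" "H2 \<subseteq> U" "\<And>k. Ck_on k U X'" "\<And>k. Ck_on k U Y'"
      "\<And>x. x \<in> H2 \<Longrightarrow> X' x = X x" "\<And>x. x \<in> H2 \<Longrightarrow> Y' x = Y x"
      by (rule smooth_onE2[of H2 X Y]) (use X Y in \<open>auto simp: vector_field_def\<close>)
    show ?thesis
      unfolding smooth_on_def
    proof (intro exI conjI allI ballI)
      show "Ck_on k U (\<lambda>x. frechet_derivative Y' (at x) (X' x)
          + mink x (frechet_derivative Y' (at x) (X' x)) *\<^sub>R x)" for k
        by (intro Ck_on_add Ck_on_bilinear[OF _ bounded_bilinear_scaleR]
            Ck_on_bilinear[OF _ mink_bounded_bilinear] Ck_on_derivative Ck_on_id U)
      fix x assume x: "x \<in> H2"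
      then have "X x \<in> tangent_H2 x" using X by (simp add: vector_field_def)
      from H2_diff_onI[OF x this smooth_on_imp_has_derivative[OF U(1,2) U(4)[of "Suc 0"] U(6) x]]
      show "frechet_derivative Y' (at x) (X' x)
          + mink x (frechet_derivative Y' (at x) (X' x)) *\<^sub>R x = nabla Y x (X x)"
        using x by (simp add: nabla_def U)
    qed (use U in auto)
  qed
  have 3: "nabla Y x (a *\<^sub>R u + b *\<^sub>R w) = a *\<^sub>R nabla Y x u + b *\<^sub>R nabla Y x w"
    if "?vf Y" "x \<in> H2" for Y x u w a b
  proof -
    have "linear (diff_on H2 Y x)" using d[OF that] has_derivative_linear by blast
    then show ?thesis
      by (simp add: nabla_def linear_add linear_cmul mink_simps algebra_simps)
  qed
  have 4: "nabla (\<lambda>q. Y q + Z q) x u = nabla Y x u + nabla Z x u"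
    if "?vf Y" "?vf Z" "x \<in> H2" "u \<in> tangent_H2 x" for Y Z x u
    using H2_diff_onI[OF that(3,4) has_derivative_add[OF d[OF that(1,3)] d[OF that(2,3)]]]
    by (simp add: nabla_def mink_simps algebra_simps)
  have 5: "nabla (\<lambda>q. f q *\<^sub>R Y q) x u = diff_on H2 f x u *\<^sub>R Y x + f x *\<^sub>R nabla Y x u"
    if "smooth_on H2 f" "?vf Y" "x \<in> H2" "u \<in> tangent_H2 x" for f Y x u
    using H2_diff_onI[OF that(3,4) has_derivative_scaleR[OF smooth_on_differentiable[OF that(1,3)] d[OF that(2,3)]]]
      that(2,3)
    by (simp add: nabla_def mink_simps algebra_simps vector_field_def tangent_H2_def)
  have 6: "nabla Y x (X x) - nabla X x (Y x) = diff_on H2 Y x (X x) - diff_on H2 X x (Y x)"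
    if "?vf X" "?vf Y" "x \<in> H2" for X Y x
    using nab[of Y x "X x"] nab[of X x "Y x"] that
    by (simp add: vector_field_def mink_commute)
  have 7: "diff_on H2 (\<lambda>q. mink (Y q) (Z q)) x u = mink (nabla Y x u) (Z x) + mink (Y x) (nabla Z x u)"
    if "?vf Y" "?vf Z" "x \<in> H2" "u \<in> tangent_H2 x" for Y Z x u
    using H2_diff_onI[OF that(3,4) bounded_bilinear.FDERIV[OF mink_bounded_bilinear d[OF that(1,3)] d[OF that(2,3)]]]
      that(1-3)
    by (simp add: nabla_def mink_simps algebra_simps vector_field_def tangent_H2_def mink_commute[of _ x])
  show ?thesis
    unfolding levi_civita_def affine_connection_def
    by (intro conjI allI impI ballI) (simp_all only: 1 2 3 4 5 6 7)
qed

lemma diff_graph_eq_lifts: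
  assumes V: "vector_field H2 tangent_H2 V" and x: "x \<in> H2" and w: "w \<in> tangent_H2 x"
  shows "diff_on H2 (graph_map V) x w = hlift (x, V x) w + vlift (x, V x) (nabla V x w)"
proof -
  have "(V has_derivative diff_on H2 V x) (at x within H2)"
    using V x smooth_on_differentiable unfolding vector_field_def by blast
  then have "(graph_map V has_derivative (\<lambda>w. (w, diff_on H2 V x w))) (at x within H2)"
    unfolding graph_map_def[abs_def] by (intro has_derivative_Pair) auto
  from H2_diff_onI[OF x w this] show ?thesis
    using mink_diff_field[OF V x w] by (simp add: hlift_def vlift_def nabla_def)
qed

lemma hpart_lifts: "hpart p (hlift p w1 + vlift p w2) = w1"
  and vpart_lifts: "vpart p (hlift p w1 + vlift p w2) = w2"
  by (simp_all add: hpart_def vpart_def hlift_def vlift_def)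

lemma levi_civita_tangent:
  "levi_civita M T g D \<Longrightarrow> vector_field M T Y \<Longrightarrow> p \<in> M \<Longrightarrow> u \<in> T p \<Longrightarrow> D Y p u \<in> T p"
  by (simp add: levi_civita_def affine_connection_def)

lemma levi_civita_torsion:
  "levi_civita M T g D \<Longrightarrow> vector_field M T X \<Longrightarrow> vector_field M T Y \<Longrightarrow> p \<in> M \<Longrightarrow>
     D Y p (X p) - D X p (Y p) = diff_on M Y p (X p) - diff_on M X p (Y p)"
  by (simp add: levi_civita_def)

lemma levi_civita_metric:
  "levi_civita M T g D \<Longrightarrow> vector_field M T Y \<Longrightarrow> vector_field M T Z \<Longrightarrow> p \<in> M \<Longrightarrow> u \<in> T p \<Longrightarrow>
     diff_on M (\<lambda>q. g q (Y q) (Z q)) p u = g p (D Y p u) (Z p) + g p (Y p) (D Z p u)"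
  by (simp add: levi_civita_def)

lemma levi_civita_unique:
  assumes D: "levi_civita M T g D" "levi_civita M T g D'" and p: "p \<in> M"
    and sub: "subspace (T p)" and bil: "bilinear (g p)" and sym: "\<And>u v. g p u v = g p v u"
    and nondeg: "\<And>u. u \<in> T p \<Longrightarrow> (\<And>v. v \<in> T p \<Longrightarrow> g p u v = 0) \<Longrightarrow> u = 0"
    and ext: "\<And>u. u \<in> T p \<Longrightarrow> \<exists>X. vector_field M T X \<and> X p = u"
    and Y: "vector_field M T Y" and u: "u \<in> T p"
  shows "D Y p u = D' Y p u"
proof -
  let ?vf = "vector_field M T"
  define S where "S X Y = D Y p (X p) - D' Y p (X p)" for X Y
  have T: "X p \<in> T p" if "?vf X" for X
    using that p by (simp add: vector_field_def)
  have ST: "S X Y \<in> T p" if "?vf X" "?vf Y" for X Y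
    unfolding S_def
    by (intro subspace_diff sub levi_civita_tangent[OF D(1)] levi_civita_tangent[OF D(2)] T that p)
  have Scomm: "S X Y = S Y X" if "?vf X" "?vf Y" for X Y
  proof -
    have "D Y p (X p) - D X p (Y p) = D' Y p (X p) - D' X p (Y p)"
      using levi_civita_torsion[OF D(1) that p] levi_civita_torsion[OF D(2) that p] by simp
    then show ?thesis by (simp add: S_def algebra_simps)
  qed
  have Sskew: "g p (S X Y) Z = - g p (S X Z') Y'"
    if "?vf X" "?vf Y" "?vf Z'" "Z' p = Z" "Y p = Y'" for X Y Z Z' Y'
  proof -
    have "g p (D Y p (X p)) (Z' p) + g p (Y p) (D Z' p (X p)) =
        g p (D' Y p (X p)) (Z' p) + g p (Y p) (D' Z' p (X p))"
      using levi_civita_metric[OF D(1) that(2,3) p T[OF that(1)]]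
        levi_civita_metric[OF D(2) that(2,3) p T[OF that(1)]] by simp
    then show ?thesis
      using that(4,5) by (simp add: S_def bilinear_lsub[OF bil] bilinear_rsub[OF bil] sym)
  qed
  obtain X where X: "?vf X" "X p = u" using ext[OF u] by blast
  have "g p (S X Y) v = 0" if v: "v \<in> T p" for v
  proof -
    obtain Z where Z: "?vf Z" "Z p = v" using ext[OF v] by blast
    have "g p (S X Y) (Z p) = - g p (S X Z) (Y p)" using Sskew X Y Z by blast
    also have "\<dots> = - g p (S Z X) (Y p)" using Scomm X Z by simp
    also have "\<dots> = g p (S Z Y) (X p)" using Sskew[of Z X Y "Y p" "X p"] X Y Z by simp
    also have "\<dots> = g p (S Y Z) (X p)" using Scomm Y Z by simp
    also have "\<dots> = - g p (S Y X) (Z p)" using Sskew X Y Z by blast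
    also have "\<dots> = - g p (S X Y) (Z p)" using Scomm X Y by simp
    finally show ?thesis using Z by simp
  qed
  then have "S X Y = 0" using nondeg[OF ST[OF X(1) Y]] by blast
  then show ?thesis by (simp add: S_def X)
qed

lemma mink_tangent_proj:
  "x \<in> H2 \<Longrightarrow> y + mink x y *\<^sub>R x \<in> tangent_H2 x"
  by (simp add: tangent_H2_def H2_def mink_simps)

lemma tangent_H2_nondegenerate:
  assumes x: "x \<in> H2" and w: "w \<in> tangent_H2 x" and 0: "\<And>u. u \<in> tangent_H2 x \<Longrightarrow> mink w u = 0"
  shows "w = 0"
proof (rule mink_nondegenerate)
  fix y
  have "mink w (y + mink x y *\<^sub>R x) = 0"
    by (rule 0[OF mink_tangent_proj[OF x]])
  then show "mink w y = mink 0 y"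
    using w by (simp add: mink_simps tangent_H2_def mink_commute[of w x]) (simp add: mink_def)
qed

lemma levi_civita_GG_unique:
  assumes D: "levi_civita TH2 tangent_TH2 GG D" "levi_civita TH2 tangent_TH2 GG D'"
    and p: "p \<in> TH2" and Y: "vector_field TH2 tangent_TH2 Y" and u: "u \<in> tangent_TH2 p"
  shows "D Y p u = D' Y p u"
proof (rule levi_civita_unique[OF D p _ _ _ _ _ Y u])
  have x: "fst p \<in> H2" using p by (auto simp: TH2_def)
  have mem: "\<xi> \<in> tangent_TH2 q \<longleftrightarrow> hpart q \<xi> \<in> tangent_H2 (fst q) \<and> vpart q \<xi> \<in> tangent_H2 (fst q)" for q \<xi>
  proof -
    have "\<xi> = hlift q (hpart q \<xi>) + vlift q (vpart q \<xi>)"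
      by (simp add: hlift_def vlift_def hpart_def vpart_def prod_eq_iff)
    then show ?thesis
      unfolding tangent_TH2_def by (auto simp: hpart_lifts vpart_lifts)
  qed
  have lin: "linear (hpart p)" "linear (vpart p)"
    by (auto intro!: linearI simp: hpart_def vpart_def hlift_def mink_simps algebra_simps)
  have subH: "subspace (tangent_H2 x)" for x
    by (auto simp: subspace_def tangent_H2_def mink_simps) (simp add: mink_def)
  show "subspace (tangent_TH2 p)"
    using subH[of "fst p"] lin
    by (auto simp: subspace_def mem linear_0 linear_add linear_cmul)
  show "bilinear (GG p)"
    unfolding bilinear_def
    by (intro conjI allI linearI)
      (simp_all add: GG_def linear_add[OF lin(1)] linear_add[OF lin(2)]
        linear_cmul[OF lin(1)] linear_cmul[OF lin(2)] mink_simps algebra_simps)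
  show "GG p \<xi> \<zeta> = GG p \<zeta> \<xi>" for \<xi> \<zeta>
    by (simp add: GG_def mink_commute)
  show "\<xi> = 0" if "\<xi> \<in> tangent_TH2 p" "\<And>\<zeta>. \<zeta> \<in> tangent_TH2 p \<Longrightarrow> GG p \<xi> \<zeta> = 0" for \<xi>
  proof -
    have 0: "mink (hpart p \<xi>) w2 + mink (vpart p \<xi>) w1 = 0"
      if "w1 \<in> tangent_H2 (fst p)" "w2 \<in> tangent_H2 (fst p)" for w1 w2
      using that \<open>\<And>\<zeta>. \<zeta> \<in> tangent_TH2 p \<Longrightarrow> GG p \<xi> \<zeta> = 0\<close>[of "hlift p w1 + vlift p w2"]
      by (auto simp: GG_def hpart_lifts vpart_lifts mem)
    have z: "0 \<in> tangent_H2 (fst p)" "mink y 0 = 0" for y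
      by (simp_all add: tangent_H2_def mink_def)
    have "hpart p \<xi> = 0"
      using 0[OF z(1)] that(1) by (intro tangent_H2_nondegenerate[OF x]) (auto simp: mem z)
    moreover have "vpart p \<xi> = 0"
      using 0[OF _ z(1)] that(1) by (intro tangent_H2_nondegenerate[OF x]) (auto simp: mem z)
    ultimately show ?thesis
      by (auto simp: hpart_def vpart_def hlift_def prod_eq_iff mink_def)
  qed
  show "\<exists>X. vector_field TH2 tangent_TH2 X \<and> X p = \<xi>" if "\<xi> \<in> tangent_TH2 p" for \<xi>
  proof -
    define P :: "real^3 \<Rightarrow> (real^3) \<times> (real^3) \<Rightarrow> real^3" where
      "P y q = y + mink (fst q) y *\<^sub>R fst q" for y q
    define X where "X q = (P (hpart p \<xi>) q,
      mink (P (hpart p \<xi>) q) (snd q) *\<^sub>R fst q + P (vpart p \<xi>) q)" for q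
    have P: "Ck_on k UNIV (P y)" for k y
      unfolding P_def
      by (intro Ck_on_add Ck_on_bilinear[OF _ bounded_bilinear_scaleR]
          Ck_on_bilinear[OF _ mink_bounded_bilinear] Ck_on_const
          Ck_on_linear[OF _ bounded_linear_fst] Ck_on_id open_UNIV)
    have S: "Ck_on k UNIV (\<lambda>q. mink (P (hpart p \<xi>) q) (snd q) *\<^sub>R fst q + P (vpart p \<xi>) q)" for k
      by (intro Ck_on_add Ck_on_bilinear[OF _ bounded_bilinear_scaleR]
          Ck_on_bilinear[OF _ mink_bounded_bilinear] P
          Ck_on_linear[OF _ bounded_linear_fst] Ck_on_linear[OF _ bounded_linear_snd]
          Ck_on_id open_UNIV)
    have "Ck_on k UNIV (\<lambda>q. (P (hpart p \<xi>) q, 0) +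
        (0, mink (P (hpart p \<xi>) q) (snd q) *\<^sub>R fst q + P (vpart p \<xi>) q))" for k
      by (intro Ck_on_add open_UNIV
          Ck_on_linear[OF _ bounded_linear_Pair[OF bounded_linear_ident bounded_linear_zero] P]
          Ck_on_linear[OF _ bounded_linear_Pair[OF bounded_linear_zero bounded_linear_ident] S])
    then have "Ck_on k UNIV X" for k
      by (simp add: X_def[abs_def])
    then have "smooth_on TH2 X"
      unfolding smooth_on_def by blast
    moreover have "X q \<in> tangent_TH2 q" if "q \<in> TH2" for q
    proof -
      have "fst q \<in> H2" using that by (auto simp: TH2_def)
      then show ?thesis
        using mink_tangent_proj by (auto simp: mem X_def hpart_def vpart_def hlift_def P_def)
    qed
    moreover have "X p = \<xi>"
      using that
      by (auto simp: mem X_def P_def tangent_H2_def hpart_def vpart_def hlift_def prod_eq_iff)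
    ultimately show ?thesis
      unfolding vector_field_def by blast
  qed
qed

end

theory Submission
  imports Defs
begin

text \<open>A continuous tangent field on the circle is \<open>X(z) = f(z) i z\<close> with a continuous function \<open>f\<close>. Let
  \<open>\<ell>(t) = (1, cos t, sin t)\<close>, a light-like vector, and
  \<open>u(x) = (1 / 2\<pi>) \<integral> f(e\<^sup>i\<^sup>t) \<langle>x, \<ell>(t)\<rangle>\<^sup>-\<^sup>2 dt\<close> for \<open>x\<close> in the hyperbolic plane. Each function
  \<open>\<langle>x, \<ell>\<rangle>\<^sup>-\<^sup>2\<close> satisfies \<open>\<Delta>u = 2u\<close>, hence so does their superposition, and \<open>u / x\<^sub>0\<close> has the boundary
  values \<open>f\<close> in the Klein model. The vector field sought is \<open>V = J grad u\<close>. It is Lagrangian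
  because Hessians are symmetric. The horizontal part of its tension field is that of the identity map,
  which vanishes, and the vertical part is \<open>tr \<nabla>\<^sup>2V + tr R(V, \<cdot>)\<cdot> = J grad (\<Delta>u - 2u) = 0\<close>.

  The formal proof works with \<open>V(x) = (1 / \<pi>) \<integral> f(e\<^sup>i\<^sup>t) (- \<langle>x, \<ell>(t)\<rangle>)\<^sup>-\<^sup>3 x \<boxtimes> \<ell>(t) dt\<close> instead of \<open>u\<close>. This
  formula makes sense in the whole future cone, and there all derivatives of \<open>V\<close> are integrals of the
  same type. The geometry of the target is made just as explicit: \<open>TH2\<close> with \<open>GG\<close> is a submanifold of
  the flat tangent bundle of Minkowski space, so that its Levi-Civita connection is a tangential
  projection (\<open>levi_civita_nabla_TH2\<close>) and harmonicity becomes the linear second-order equation in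
  \<open>harmonic_fieldI\<close>. Both conditions on \<open>V\<close> are then algebraic identities under the integral
  (\<open>harmonic_lagrangian_poisson_field\<close>).

  In the Klein model \<open>V\<close> is the integral of \<open>f(e\<^sup>i\<^sup>t)\<close> against an explicit vector-valued kernel. A constant
  \<open>f\<close> gives the corresponding multiple of the rotation field exactly
  (\<open>light_integral_boundary_kernel\<close>), and the kernel concentrates at the boundary point that is
  approached (\<open>Klein_push_poisson_field_bound\<close>). This yields the limit.\<close>

section \<open>The Minkowski cross product\<close>

lemma boxtimes_bounded_bilinear: "bounded_bilinear (\<boxtimes>)"
  unfolding bilinear_conv_bounded_bilinear[symmetric] bilinear_def
  by (intro conjI allI linearI) (simp_all add: boxtimes_explicit vec_eq_iff forall_3 algebra_simps)

lemmas boxtimes_simps =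
  bounded_bilinear.add_left[OF boxtimes_bounded_bilinear]
  bounded_bilinear.add_right[OF boxtimes_bounded_bilinear]
  bounded_bilinear.scaleR_left[OF boxtimes_bounded_bilinear]
  bounded_bilinear.scaleR_right[OF boxtimes_bounded_bilinear]

lemma mink_zero [simp]: "mink 0 y = 0" "mink y 0 = 0"
  by (simp_all add: mink_def)

text \<open>Lagrange's identity; the sign against the Euclidean one is the determinant of the Minkowski form.\<close>

lemma mink_boxtimes_boxtimes:
  "mink (a \<boxtimes> b) (c \<boxtimes> d) = mink a d * mink b c - mink a c * mink b d"
  by (simp add: boxtimes_explicit mink_def algebra_simps)

lemma mink_boxtimes_self: "mink x (x \<boxtimes> y) = 0"
  by (simp add: boxtimes_explicit mink_def algebra_simps)

section \<open>The tangent bundle of the hyperbolic plane in a flat space\<close>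

text \<open>This is the flat metric of signature \<open>(3,3)\<close> on the tangent bundle of Minkowski space, and the
  tangent bundle of \<open>H2\<close> with its metric \<open>GG\<close> is isometrically embedded in it: the horizontal
  correction in \<open>vpart\<close> is a multiple of \<open>x\<close>, which is invisible against vectors tangent to \<open>H2\<close>.
  At \<open>p = (x, v)\<close> the normal plane is spanned by \<open>(0, x)\<close> and by \<open>p\<close> itself, the gradients of
  half of \<open>\<langle>x, x\<rangle>\<close> and of \<open>\<langle>x, v\<rangle>\<close>. Hence the Levi-Civita connection of \<open>GG\<close> is, as for \<open>H2\<close>
  in Minkowski space, the tangential projection of the flat derivative.\<close>

definition neutral_form :: "(real^3) \<times> (real^3) \<Rightarrow> (real^3) \<times> (real^3) \<Rightarrow> real" where
  "neutral_form \<xi> \<zeta> = mink (fst \<xi>) (snd \<zeta>) + mink (snd \<xi>) (fst \<zeta>)"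

lemma neutral_form_commute: "neutral_form \<xi> \<zeta> = neutral_form \<zeta> \<xi>"
  by (simp add: neutral_form_def mink_commute)

lemma neutral_form_simps:
  "neutral_form (x + y) z = neutral_form x z + neutral_form y z" "neutral_form x (y + z) = neutral_form x y + neutral_form x z"
  "neutral_form (x - y) z = neutral_form x z - neutral_form y z" "neutral_form x (y - z) = neutral_form x y - neutral_form x z"
  "neutral_form (a *\<^sub>R x) z = a * neutral_form x z" "neutral_form x (a *\<^sub>R z) = a * neutral_form x z"
  by (simp_all add: neutral_form_def mink_simps algebra_simps)

lemma neutral_form_bounded_bilinear: "bounded_bilinear neutral_form"
  unfolding bilinear_conv_bounded_bilinear[symmetric] bilinear_def
  by (intro conjI allI linearI) (simp_all add: neutral_form_simps)

lemma TH2_normals: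
  assumes "p \<in> TH2"
  shows "neutral_form p p = 0" "neutral_form p (0, fst p) = -1" "neutral_form (0, fst p) (0, fst p) = 0"
    "mink (fst p) (fst p) = -1" "mink (fst p) (snd p) = 0" "fst p \<in> H2"
  using assms by (auto simp: TH2_def H2_def tangent_H2_def neutral_form_def mink_commute)

lemma tangent_TH2_iff:
  assumes "p \<in> TH2"
  shows "\<xi> \<in> tangent_TH2 p \<longleftrightarrow> neutral_form \<xi> p = 0 \<and> neutral_form \<xi> (0, fst p) = 0"
proof
  assume "\<xi> \<in> tangent_TH2 p"
  then obtain w1 w2 where w: "\<xi> = hlift p w1 + vlift p w2"
    "mink (fst p) w1 = 0" "mink (fst p) w2 = 0"
    by (auto simp: tangent_TH2_def tangent_H2_def)
  then show "neutral_form \<xi> p = 0 \<and> neutral_form \<xi> (0, fst p) = 0"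
    using TH2_normals(4)[OF assms] mink_commute[of w1 "fst p"] mink_commute[of w2 "fst p"]
    by (simp add: neutral_form_def hlift_def vlift_def mink_simps)
next
  assume *: "neutral_form \<xi> p = 0 \<and> neutral_form \<xi> (0, fst p) = 0"
  have "\<xi> = hlift p (fst \<xi>) + vlift p (snd \<xi> - mink (fst \<xi>) (snd p) *\<^sub>R fst p)"
    by (simp add: hlift_def vlift_def prod_eq_iff)
  moreover have "fst \<xi> \<in> tangent_H2 (fst p)"
    using * by (simp add: neutral_form_def tangent_H2_def mink_commute)
  moreover have "snd \<xi> - mink (fst \<xi>) (snd p) *\<^sub>R fst p \<in> tangent_H2 (fst p)"
    using * TH2_normals(4)[OF assms] mink_commute[of "snd \<xi>" "fst p"]
    by (simp add: neutral_form_def tangent_H2_def mink_simps)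
  ultimately show "\<xi> \<in> tangent_TH2 p"
    unfolding tangent_TH2_def by blast
qed

lemma GG_eq_neutral_form:
  assumes "p \<in> TH2" "\<xi> \<in> tangent_TH2 p" "\<zeta> \<in> tangent_TH2 p"
  shows "GG p \<xi> \<zeta> = neutral_form \<xi> \<zeta>"
proof -
  have "mink (fst \<xi>) (fst p) = 0" "mink (fst \<zeta>) (fst p) = 0"
    using assms tangent_TH2_iff by (simp_all add: neutral_form_def)
  then show ?thesis
    using mink_commute[of "fst p" "fst \<zeta>"]
    by (simp add: GG_def hpart_def vpart_def hlift_def neutral_form_def mink_simps)
qed

text \<open>A tangent vector is the sum of a horizontal and a vertical one, and by linearity it suffices to treat
  these. A vertical vector is the velocity of a straight line in the fibre. A horizontal one is the
  image of \<open>w\<close> under the differential of the section \<open>W\<close> of \<open>TH2\<close> obtained by projecting the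
  constant vector \<open>v\<close> to the tangent planes, so that uniqueness on \<open>H2\<close> applies.\<close>

lemma TH2_has_derivative_unique:
  assumes p: "p \<in> TH2" and \<xi>: "\<xi> \<in> tangent_TH2 p"
    and f: "(f has_derivative f') (at p within TH2)" "(f has_derivative f'') (at p within TH2)"
  shows "f' \<xi> = f'' \<xi>"
proof -
  obtain x v where pxv: "p = (x, v)" by (cases p)
  have x: "x \<in> H2" and v: "v \<in> tangent_H2 x" using p pxv by (auto simp: TH2_def)
  have lin: "linear f'" "linear f''"
    using f has_derivative_linear by blast+
  have hor: "f' (hlift p w) = f'' (hlift p w)" if w: "w \<in> tangent_H2 x" for w
  proof -
    define W where "W y = v + mink y v *\<^sub>R y" for y
    have Wx: "W x = v" using v by (simp add: W_def tangent_H2_def)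
    have "(W has_derivative (\<lambda>w. mink w v *\<^sub>R x)) (at x within H2)"
      unfolding W_def using v
      by (auto intro!: derivative_eq_intros bounded_linear.has_derivative[OF
            bounded_bilinear.bounded_linear_left[OF mink_bounded_bilinear]]
          simp: tangent_H2_def)
    then have dW: "(graph_map W has_derivative hlift p) (at x within H2)"
      unfolding graph_map_def[abs_def] hlift_def[abs_def] pxv
      by (auto intro: has_derivative_Pair)
    have sub: "graph_map W ` H2 \<subseteq> TH2"
      using mink_tangent_proj[of _ v] by (auto simp: graph_map_def TH2_def W_def)
    have "(f \<circ> graph_map W has_derivative h \<circ> hlift p) (at x within H2)"
      if "(f has_derivative h) (at p within TH2)" for h
      using diff_chain_within[OF dW, of f h] has_derivative_subset[OF that sub] Wx
      by (simp add: graph_map_def pxv)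
    from H2_has_derivative_unique[OF x w this[OF f(1)] this[OF f(2)]]
    show ?thesis by simp
  qed
  have ver: "f' (vlift p w) = f'' (vlift p w)" if w: "w \<in> tangent_H2 x" for w
  proof -
    define c where "c t = (x, v + t *\<^sub>R w)" for t :: real
    have dc: "(c has_derivative (\<lambda>t. t *\<^sub>R vlift p w)) (at 0)"
      unfolding c_def vlift_def
      by (auto intro!: derivative_eq_intros simp: fun_eq_iff)
    have sub: "range c \<subseteq> TH2"
      using x v w by (auto simp: c_def TH2_def tangent_H2_def mink_simps)
    have "(f \<circ> c has_derivative h \<circ> (\<lambda>t. t *\<^sub>R vlift p w)) (at 0)"
      if "(f has_derivative h) (at p within TH2)" for h
      using diff_chain_within[OF dc, of f h] has_derivative_subset[OF that sub]
      by (simp add: c_def pxv)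
    from has_derivative_unique[OF this[OF f(1)] this[OF f(2)]]
    have "(f' \<circ> (\<lambda>t. t *\<^sub>R vlift p w)) 1 = (f'' \<circ> (\<lambda>t. t *\<^sub>R vlift p w)) 1" by (rule fun_cong)
    then show ?thesis by simp
  qed
  show ?thesis
    using \<xi> hor ver unfolding tangent_TH2_def
    by (auto simp: linear_add[OF lin(1)] linear_add[OF lin(2)] pxv)
qed

lemma TH2_diff_onI:
  assumes "p \<in> TH2" "\<xi> \<in> tangent_TH2 p" "(f has_derivative f') (at p within TH2)"
  shows "diff_on TH2 f p \<xi> = f' \<xi>"
proof -
  have "(f has_derivative diff_on TH2 f p) (at p within TH2)"
    using assms(3) frechet_derivative_works differentiable_def by blast
  from TH2_has_derivative_unique[OF assms(1,2) this assms(3)] show ?thesis .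
qed

text \<open>The two normals \<open>(0, x)\<close> and \<open>p\<close> are light-like with product \<open>-1\<close>; therefore the coefficient of each
  is the product with the other one.\<close>

definition tang_proj :: "(real^3) \<times> (real^3) \<Rightarrow> (real^3) \<times> (real^3) \<Rightarrow> (real^3) \<times> (real^3)" where
  "tang_proj p \<zeta> = \<zeta> + neutral_form \<zeta> p *\<^sub>R (0, fst p) + neutral_form \<zeta> (0, fst p) *\<^sub>R p"

definition nabla_TH2 ::
  "((real^3) \<times> (real^3) \<Rightarrow> (real^3) \<times> (real^3)) \<Rightarrow> (real^3) \<times> (real^3) \<Rightarrow> (real^3) \<times> (real^3) \<Rightarrow>
     (real^3) \<times> (real^3)" where
  "nabla_TH2 Y p u = tang_proj p (diff_on TH2 Y p u)"

lemma linear_tang_proj: "linear (tang_proj p)"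
  by (rule linearI) (simp_all add: tang_proj_def neutral_form_simps algebra_simps del: scaleR_Pair)

lemma tang_proj_tangent: "p \<in> TH2 \<Longrightarrow> tang_proj p \<zeta> \<in> tangent_TH2 p"
  using neutral_form_commute[of "(0, fst p)" p]
  by (simp add: tangent_TH2_iff tang_proj_def neutral_form_simps TH2_normals del: scaleR_Pair)

lemma tang_proj_id: "p \<in> TH2 \<Longrightarrow> \<xi> \<in> tangent_TH2 p \<Longrightarrow> tang_proj p \<xi> = \<xi>"
  by (simp add: tangent_TH2_iff tang_proj_def zero_prod_def[symmetric])

lemma neutral_form_tang_proj:
  "p \<in> TH2 \<Longrightarrow> \<xi> \<in> tangent_TH2 p \<Longrightarrow> neutral_form (tang_proj p \<zeta>) \<xi> = neutral_form \<zeta> \<xi>"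
  using neutral_form_commute[of _ \<xi>]
  by (simp add: tangent_TH2_iff tang_proj_def neutral_form_simps del: scaleR_Pair)

lemma bounded_linear_vert: "bounded_linear (\<lambda>q :: (real^3) \<times> (real^3). (0 :: real^3, fst q))"
  by (intro bounded_linear_Pair bounded_linear_zero bounded_linear_fst)

text \<open>Differentiating the orthogonality of \<open>Y\<close> to the two normals turns the normal components of the
  derivative into the second fundamental form. It is symmetric in \<open>Y p\<close> and \<open>u\<close>, which is what
  makes the connection torsion-free.\<close>

lemma nabla_TH2_field:
  assumes Y: "vector_field TH2 tangent_TH2 Y" and p: "p \<in> TH2" and u: "u \<in> tangent_TH2 p"
  shows "nabla_TH2 Y p u =
    diff_on TH2 Y p u - neutral_form (Y p) u *\<^sub>R (0, fst p) - neutral_form (Y p) (0, fst u) *\<^sub>R p"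
proof -
  have d: "(Y has_derivative diff_on TH2 Y p) (at p within TH2)"
    using Y p smooth_on_differentiable unfolding vector_field_def by blast
  have T: "neutral_form (Y q) q = 0 \<and> neutral_form (Y q) (0, fst q) = 0" if "q \<in> TH2" for q
    using Y that by (auto simp: vector_field_def tangent_TH2_iff)
  have "neutral_form (Y p) (h u) + neutral_form (diff_on TH2 Y p u) (h p) = 0"
    if h: "bounded_linear h" "\<And>q. q \<in> TH2 \<Longrightarrow> neutral_form (Y q) (h q) = 0" for h
  proof -
    have "((\<lambda>q. neutral_form (Y q) (h q)) has_derivative
        (\<lambda>u. neutral_form (Y p) (h u) + neutral_form (diff_on TH2 Y p u) (h p))) (at p within TH2)"
      by (intro bounded_bilinear.FDERIV[OF neutral_form_bounded_bilinear] d
          bounded_linear_imp_has_derivative h)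
    moreover have "((\<lambda>q. neutral_form (Y q) (h q)) has_derivative (\<lambda>u. 0)) (at p within TH2)"
      by (rule has_derivative_transform[OF p, of _ "\<lambda>x. 0"]) (use h in auto)
    ultimately show ?thesis
      using TH2_has_derivative_unique[OF p u] by blast
  qed
  from this[OF bounded_linear_ident] this[OF bounded_linear_vert] T
  have "neutral_form (diff_on TH2 Y p u) p = - neutral_form (Y p) u"
    "neutral_form (diff_on TH2 Y p u) (0, fst p) = - neutral_form (Y p) (0, fst u)"
    by auto
  then show ?thesis
    by (simp add: nabla_TH2_def tang_proj_def del: scaleR_Pair)
qed

lemma levi_civita_nabla_TH2: "levi_civita TH2 tangent_TH2 GG nabla_TH2"
proof -
  let ?vf = "vector_field TH2 tangent_TH2"
  have d: "(Y has_derivative diff_on TH2 Y p) (at p within TH2)" if "?vf Y" "p \<in> TH2" for Y p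
    using that smooth_on_differentiable unfolding vector_field_def by blast
  have T: "Y p \<in> tangent_TH2 p" if "?vf Y" "p \<in> TH2" for Y p
    using that by (simp add: vector_field_def)
  have 1: "nabla_TH2 Y p w \<in> tangent_TH2 p" if "p \<in> TH2" for Y p w
    using that by (simp add: nabla_TH2_def tang_proj_tangent)
  have 2: "smooth_on TH2 (\<lambda>p. nabla_TH2 Y p (X p))" if X: "?vf X" and Y: "?vf Y" for X Y
  proof -
    obtain U X' Y' where U: "open U" "TH2 \<subseteq> U" "\<And>k. Ck_on k U X'" "\<And>k. Ck_on k U Y'"
      "\<And>x. x \<in> TH2 \<Longrightarrow> X' x = X x" "\<And>x. x \<in> TH2 \<Longrightarrow> Y' x = Y x"
      by (rule smooth_onE2[of TH2 X Y]) (use X Y in \<open>auto simp: vector_field_def\<close>)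
    show ?thesis
      unfolding smooth_on_def
    proof (intro exI conjI allI ballI)
      show "Ck_on k U (\<lambda>p. tang_proj p (frechet_derivative Y' (at p) (X' p)))" for k
        unfolding tang_proj_def
        by (intro Ck_on_add Ck_on_bilinear[OF _ bounded_bilinear_scaleR]
            Ck_on_bilinear[OF _ neutral_form_bounded_bilinear] Ck_on_derivative Ck_on_id U
            Ck_on_linear[OF _ bounded_linear_vert])
      fix p assume p: "p \<in> TH2"
      from TH2_diff_onI[OF p T[OF X p] smooth_on_imp_has_derivative[OF U(1,2) U(4)[of "Suc 0"] U(6) p]]
      show "tang_proj p (frechet_derivative Y' (at p) (X' p)) = nabla_TH2 Y p (X p)"
        using p by (simp add: nabla_TH2_def U)
    qed (use U in auto)
  qed
  note lin = linear_add[OF linear_tang_proj] linear_cmul[OF linear_tang_proj]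
  have 3: "nabla_TH2 Y p (a *\<^sub>R u + b *\<^sub>R w) = a *\<^sub>R nabla_TH2 Y p u + b *\<^sub>R nabla_TH2 Y p w"
    if "?vf Y" "p \<in> TH2" for Y p u w a b
  proof -
    have "linear (diff_on TH2 Y p)" using d[OF that] has_derivative_linear by blast
    then show ?thesis
      by (simp add: nabla_TH2_def linear_add linear_cmul lin)
  qed
  have 4: "nabla_TH2 (\<lambda>q. Y q + Z q) p u = nabla_TH2 Y p u + nabla_TH2 Z p u"
    if "?vf Y" "?vf Z" "p \<in> TH2" "u \<in> tangent_TH2 p" for Y Z p u
    using TH2_diff_onI[OF that(3,4) has_derivative_add[OF d[OF that(1,3)] d[OF that(2,3)]]]
    by (simp add: nabla_TH2_def lin)
  have 5: "nabla_TH2 (\<lambda>q. f q *\<^sub>R Y q) p u = diff_on TH2 f p u *\<^sub>R Y p + f p *\<^sub>R nabla_TH2 Y p u"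
    if "smooth_on TH2 f" "?vf Y" "p \<in> TH2" "u \<in> tangent_TH2 p" for f Y p u
    using TH2_diff_onI[OF that(3,4) has_derivative_scaleR[OF smooth_on_differentiable[OF that(1,3)] d[OF that(2,3)]]]
    by (simp add: nabla_TH2_def lin tang_proj_id[OF that(3) T[OF that(2,3)]])
  have 6: "nabla_TH2 Y p (X p) - nabla_TH2 X p (Y p) = diff_on TH2 Y p (X p) - diff_on TH2 X p (Y p)"
    if "?vf X" "?vf Y" "p \<in> TH2" for X Y p
    using nabla_TH2_field[OF that(2,3) T[OF that(1,3)]] nabla_TH2_field[OF that(1,3) T[OF that(2,3)]]
    by (simp add: neutral_form_commute[of "X p" "Y p"]) (simp add: neutral_form_def mink_commute)
  have 7: "diff_on TH2 (\<lambda>q. GG q (Y q) (Z q)) p u =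
      GG p (nabla_TH2 Y p u) (Z p) + GG p (Y p) (nabla_TH2 Z p u)"
    if "?vf Y" "?vf Z" "p \<in> TH2" "u \<in> tangent_TH2 p" for Y Z p u
  proof -
    have "((\<lambda>q. GG q (Y q) (Z q)) has_derivative
        (\<lambda>u. neutral_form (Y p) (diff_on TH2 Z p u) + neutral_form (diff_on TH2 Y p u) (Z p))) (at p within TH2)"
      by (rule has_derivative_transform[OF that(3) _ bounded_bilinear.FDERIV[OF neutral_form_bounded_bilinear
              d[OF that(1,3)] d[OF that(2,3)]]]) (simp add: GG_eq_neutral_form T that)
    from TH2_diff_onI[OF that(3,4) this] show ?thesis
      using neutral_form_tang_proj[OF that(3) T[OF that(2,3)]] neutral_form_tang_proj[OF that(3) T[OF that(1,3)]]
      by (simp add: GG_eq_neutral_form that T 1)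
        (simp add: nabla_TH2_def neutral_form_commute[of "Y p"])
  qed
  show ?thesis
    unfolding levi_civita_def affine_connection_def
    by (intro conjI allI impI ballI) (simp_all only: 1 2 3 4 5 6 7)
qed

section \<open>Harmonicity and the Lagrangian condition in terms of ambient derivatives\<close>

text \<open>Cramer's rule for the three equations that prescribe the products of \<open>z\<close> with \<open>a\<close>, \<open>b\<close>, \<open>c\<close>.\<close>

lemma det_scaleR_eq_boxtimes:
  "mink (a \<boxtimes> b) c *\<^sub>R z = mink z c *\<^sub>R (a \<boxtimes> b) + mink z a *\<^sub>R (b \<boxtimes> c) + mink z b *\<^sub>R (c \<boxtimes> a)"
  by (simp add: boxtimes_explicit mink_def vec_eq_iff forall_3 algebra_simps)

lemma orthonormal_expansion:
  assumes "x \<in> H2" "mink x a = 0" "mink x b = 0" "mink a a = 1" "mink b b = 1" "mink a b = 0"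
  shows "mink a y *\<^sub>R a + mink b y *\<^sub>R b = y + mink x y *\<^sub>R x"
proof -
  define z where "z = y + mink x y *\<^sub>R x - mink a y *\<^sub>R a - mink b y *\<^sub>R b"
  have x: "mink x x = -1" using assms(1) by (simp add: H2_def)
  have o: "mink b a = 0" "mink a x = 0" "mink b x = 0"
    using assms(2,3,6) by (simp_all add: mink_commute)
  \<comment> \<open>\<open>z\<close> is orthogonal to the frame, and the frame is nondegenerate.\<close>
  have "mink z x = 0" "mink z a = 0" "mink z b = 0"
    using mink_commute[of y] by (simp_all add: z_def mink_simps assms x o)
  then have "mink (a \<boxtimes> b) x *\<^sub>R z = 0"
    by (simp add: det_scaleR_eq_boxtimes)
  moreover have "mink (a \<boxtimes> b) x \<noteq> 0"
  proof
    assume 0: "mink (a \<boxtimes> b) x = 0"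
    have "x \<boxtimes> (a \<boxtimes> b \<boxtimes> x) = - mink x x *\<^sub>R (a \<boxtimes> b) + mink (a \<boxtimes> b) x *\<^sub>R x"
      by (simp add: boxtimes_explicit mink_def vec_eq_iff forall_3 algebra_simps)
    moreover have "a \<boxtimes> b \<boxtimes> x = mink b x *\<^sub>R a - mink a x *\<^sub>R b"
      by (simp add: boxtimes_explicit mink_def vec_eq_iff forall_3 algebra_simps)
    moreover have "x \<boxtimes> 0 = 0"
      by (simp add: boxtimes_explicit vec_eq_iff forall_3)
    ultimately have "a \<boxtimes> b = 0"
      using x o 0 by simp
    moreover have "mink (a \<boxtimes> b) (a \<boxtimes> b) = -1"
      by (simp add: mink_boxtimes_boxtimes assms o)
    ultimately show False by simp
  qed
  ultimately have "z = 0" by (simp only: scaleR_eq_0_iff) blast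
  then show ?thesis by (simp add: z_def algebra_simps)
qed

lemma nabla_unit_field:
  assumes E: "vector_field H2 tangent_H2 E" and x: "x \<in> H2" and "mink (E x) (E x) = 1"
  shows "nabla E x (E x) = diff_on H2 E x (E x) - x"
  using mink_diff_field[OF E x, of "E x"] assms by (simp add: nabla_def vector_field_def)

text \<open>Along the graph of \<open>V\<close> the section \<open>dV(E)\<close> is \<open>(E, V'(E))\<close>. Its flat derivative in the direction
  \<open>dV(E)\<close> contains \<open>(E'(E), V'(E'(E)))\<close>, which cancels against \<open>dV(\<nabla>\<^sub>E E)\<close> except for the normal part
  \<open>E'(E) - \<nabla>\<^sub>E E = x\<close>. Thus no derivative of \<open>E\<close> is left.\<close>

lemma hessian_map_nabla_TH2:
  assumes V: "vector_field H2 tangent_H2 V"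
    and dV: "\<And>y. y \<in> H2 \<Longrightarrow> (V has_derivative V' y) (at y)"
    and ddV: "\<And>w. ((\<lambda>y. V' y w) has_derivative V'' w) (at x)"
    and lin: "linear (\<lambda>w. V'' w (E x))"
    and x: "x \<in> H2"
    and E: "vector_field H2 tangent_H2 E" "mink (E x) (E x) = 1"
    and Z: "extends_differential V E Z"
  shows "hessian_map nabla_TH2 V E E Z x =
    tang_proj (x, V x) (x, V'' (E x) (E x) + V' x x)"
proof -
  let ?E' = "diff_on H2 E x" and ?p = "(x, V x)"
  have T: "E y \<in> tangent_H2 y" if "y \<in> H2" for y
    using E(1) that by (simp add: vector_field_def)
  have p: "?p \<in> TH2"
    using x V by (auto simp: TH2_def vector_field_def)
  have dE: "(E has_derivative ?E') (at x within H2)"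
    using E(1) x smooth_on_differentiable unfolding vector_field_def by blast
  have linV: "linear (V' y)" if "y \<in> H2" for y
    using dV[OF that] has_derivative_linear by blast
  have dgraph: "(graph_map V has_derivative (\<lambda>w. (w, V' y w))) (at y within H2)"
    if "y \<in> H2" for y
    unfolding graph_map_def[abs_def]
    by (intro has_derivative_Pair has_derivative_ident has_derivative_at_withinI[OF dV[OF that]])
  have dG: "diff_on H2 (graph_map V) y w = (w, V' y w)" if "y \<in> H2" "w \<in> tangent_H2 y" for y w
    using H2_diff_onI[OF that dgraph[OF that(1)]] .
  have Zg: "Z (graph_map V y) = (E y, V' y (E y))" if "y \<in> H2" for y
    using Z that T dG by (simp add: extends_differential_def)
  \<comment> \<open>The field \<open>V'(E)\<close> is differentiated as a sum of products, since only the
  directional derivatives \<open>V' y w\<close> for fixed \<open>w\<close> are assumed differentiable.\<close>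
  have Vsum: "V' y w = (\<Sum>b\<in>Basis. (w \<bullet> b) *\<^sub>R V' y b)" if "y \<in> H2" for y w
    using linV[OF that]
    by (subst euclidean_representation[of w, symmetric]) (simp add: linear_sum linear_cmul)
  have Vsum'': "V'' (E x) (E x) = (\<Sum>b\<in>Basis. (E x \<bullet> b) *\<^sub>R V'' b (E x))"
    using linear_sum[OF lin, of "\<lambda>b. (E x \<bullet> b) *\<^sub>R b" Basis]
    by (simp add: linear_cmul[OF lin] euclidean_representation)
  have "((\<lambda>y. \<Sum>b\<in>Basis. (E y \<bullet> b) *\<^sub>R V' y b) has_derivative
      (\<lambda>h. \<Sum>b\<in>Basis. (E x \<bullet> b) *\<^sub>R V'' b h + (?E' h \<bullet> b) *\<^sub>R V' x b)) (at x within H2)"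
    by (intro has_derivative_sum has_derivative_scaleR has_derivative_at_withinI[OF ddV]
        bounded_linear.has_derivative[OF bounded_linear_inner_left dE])
  then have "((\<lambda>y. V' y (E y)) has_derivative
      (\<lambda>h. \<Sum>b\<in>Basis. (E x \<bullet> b) *\<^sub>R V'' b h + (?E' h \<bullet> b) *\<^sub>R V' x b)) (at x within H2)"
    by (rule has_derivative_transform[OF x, rotated]) (rule Vsum)
  from has_derivative_Pair[OF dE this]
  have 1: "((Z \<circ> graph_map V) has_derivative
      (\<lambda>h. (?E' h, \<Sum>b\<in>Basis. (E x \<bullet> b) *\<^sub>R V'' b h + (?E' h \<bullet> b) *\<^sub>R V' x b))) (at x within H2)"
    by (rule has_derivative_transform[OF x, rotated]) (simp add: Zg)
  have "graph_map V ` H2 \<subseteq> TH2"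
    using V by (auto simp: graph_map_def TH2_def vector_field_def)
  then have "(Z has_derivative diff_on TH2 Z ?p) (at (graph_map V x) within graph_map V ` H2)"
    unfolding graph_map_def[of V x]
  proof (rule has_derivative_subset[rotated])
    show "(Z has_derivative diff_on TH2 Z ?p) (at ?p within TH2)"
      using Z p smooth_on_differentiable unfolding extends_differential_def vector_field_def by blast
  qed
  from diff_chain_within[OF dgraph[OF x] this]
  have 2: "((Z \<circ> graph_map V) has_derivative
      (\<lambda>w. diff_on TH2 Z ?p (w, V' x w))) (at x within H2)"
    by (simp add: comp_def)
  \<comment> \<open>The chain rule along the graph shows that the derivative does not depend on the extension \<open>Z\<close>.\<close>
  have dZ: "diff_on TH2 Z ?p (E x, V' x (E x)) = (?E' (E x), V'' (E x) (E x) + V' x (?E' (E x)))"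
    using H2_has_derivative_unique[OF x T[OF x] 2 1]
    by (simp add: sum.distrib Vsum''[symmetric] Vsum[OF x, symmetric])
  have nt: "nabla E x (E x) \<in> tangent_H2 x"
    using levi_civita_tangent[OF levi_civita_nabla E(1) x T[OF x]] .
  have "(nabla E x (E x), V' x (nabla E x (E x))) \<in> tangent_TH2 ?p"
    unfolding dG[OF x nt, symmetric] diff_graph_eq_lifts[OF V x nt]
    using nt levi_civita_tangent[OF levi_civita_nabla V x nt]
    by (auto simp: tangent_TH2_def)
  then have "hessian_map nabla_TH2 V E E Z x =
    tang_proj ?p (?E' (E x), V'' (E x) (E x) + V' x (?E' (E x)))
      - tang_proj ?p (nabla E x (E x), V' x (nabla E x (E x)))"
    by (simp add: hessian_map_def dG x T nt nabla_TH2_def graph_map_def dZ tang_proj_id p)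
  then show ?thesis
    by (simp add: linear_diff[OF linear_tang_proj, symmetric] nabla_unit_field[OF E(1) x E(2)]
        linear_diff[OF linV[OF x]])
qed

text \<open>The hypothesis \<open>trace\<close> makes the trace of the Hessians the projection of \<open>(2x, 2V) = 2p\<close>, which is
  zero because \<open>p\<close> is normal to \<open>TH2\<close> at \<open>p\<close>.\<close>

lemma harmonic_fieldI:
  assumes V: "vector_field H2 tangent_H2 V"
    and dV: "\<And>x. x \<in> H2 \<Longrightarrow> (V has_derivative V' x) (at x)"
    and ddV: "\<And>x w. x \<in> H2 \<Longrightarrow> ((\<lambda>y. V' y w) has_derivative V'' x w) (at x)"
    and lin: "\<And>x h. x \<in> H2 \<Longrightarrow> linear (\<lambda>w. V'' x w h)"
    and trace: "\<And>x a b. x \<in> H2 \<Longrightarrow> mink x a = 0 \<Longrightarrow> mink x b = 0 \<Longrightarrow>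
      mink a a = 1 \<Longrightarrow> mink b b = 1 \<Longrightarrow> mink a b = 0 \<Longrightarrow>
      V'' x a a + V'' x b b + 2 *\<^sub>R V' x x = 2 *\<^sub>R V x"
  shows "harmonic_field V"
  unfolding harmonic_field_def
proof (intro exI conjI ballI allI impI)
  show "levi_civita TH2 tangent_TH2 GG nabla_TH2" by (rule levi_civita_nabla_TH2)
  fix x E1 E2 Z1 Z2
  assume x: "x \<in> H2" and E: "vector_field H2 tangent_H2 E1" "vector_field H2 tangent_H2 E2"
    "mink (E1 x) (E1 x) = 1" "mink (E2 x) (E2 x) = 1" "mink (E1 x) (E2 x) = 0"
    and Z: "extends_differential V E1 Z1" "extends_differential V E2 Z2"
  have T: "mink x (E1 x) = 0" "mink x (E2 x) = 0" "mink x (V x) = 0"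
    using x E V by (auto simp: vector_field_def tangent_H2_def)
  have *: "V'' x (E1 x) (E1 x) + V' x x + (V'' x (E2 x) (E2 x) + V' x x) = 2 *\<^sub>R V x"
    using trace[OF x T(1,2) E(3-5)] by (simp add: scaleR_2 algebra_simps)
  have "hessian_map nabla_TH2 V E1 E1 Z1 x + hessian_map nabla_TH2 V E2 E2 Z2 x =
    tang_proj (x, V x) (2 *\<^sub>R x, 2 *\<^sub>R V x)"
    using hessian_map_nabla_TH2[where V' = V' and V'' = "V'' x" and E = E1, OF V dV ddV[OF x] lin[OF x] x E(1,3) Z(1)]
      hessian_map_nabla_TH2[where V' = V' and V'' = "V'' x" and E = E2, OF V dV ddV[OF x] lin[OF x] x E(2,4) Z(2)]
    by (simp add: linear_add[OF linear_tang_proj, symmetric] * scaleR_2)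
  also have "\<dots> = 0"
    using x T(3) by (simp add: tang_proj_def neutral_form_def mink_simps mink_commute[of "V x"] H2_def)
      (simp add: zero_prod_def)
  finally show "hessian_map nabla_TH2 V E1 E1 Z1 x + hessian_map nabla_TH2 V E2 E2 Z2 x = 0" .
qed

text \<open>The vertical part of \<open>dV(w)\<close> differs from \<open>V' x w\<close> by a multiple of \<open>x\<close>, which is orthogonal to
  the image of \<open>J\<close>.\<close>

lemma lagrangian_fieldI:
  assumes V: "vector_field H2 tangent_H2 V"
    and dV: "\<And>x. x \<in> H2 \<Longrightarrow> (V has_derivative V' x) (at x)"
    and sym: "\<And>x a b. x \<in> H2 \<Longrightarrow> mink x a = 0 \<Longrightarrow> mink x b = 0 \<Longrightarrow>
      mink (x \<boxtimes> a) (V' x b) = mink (x \<boxtimes> b) (V' x a)"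
  shows "lagrangian_field V"
  unfolding lagrangian_field_def
proof (intro ballI)
  fix x a b assume x: "x \<in> H2" and a: "a \<in> tangent_H2 x" and b: "b \<in> tangent_H2 x"
  have N: "nabla V x w = V' x w + mink x (V' x w) *\<^sub>R x" if "w \<in> tangent_H2 x" for w
    using H2_diff_onI[OF x that has_derivative_at_withinI[OF dV[OF x]]] by (simp add: nabla_def)
  have "mink x (x \<boxtimes> w) = 0" "mink (x \<boxtimes> w) x = 0" for w
    using mink_boxtimes_self by (simp_all add: mink_commute)
  moreover have "mink (V' x a) (x \<boxtimes> b) = mink (x \<boxtimes> b) (V' x a)"
    by (rule mink_commute)
  ultimately show "Omega (graph_map V x) (diff_on H2 (graph_map V) x a) (diff_on H2 (graph_map V) x b) = 0"
    using sym[OF x, of a b] a b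
    by (simp add: diff_graph_eq_lifts[OF V x] Omega_def graph_map_def hpart_lifts vpart_lifts N J_def
        mink_simps tangent_H2_def)
qed

section \<open>Superpositions of powers of light-like linear forms\<close>

text \<open>These light-like vectors represent the points of the circle at infinity of \<open>H2\<close>.\<close>

definition light :: "real \<Rightarrow> real^3" where
  "light t = vector [1, cos t, sin t]"

definition future_cone :: "(real^3) set" where
  "future_cone = {x. sqrt ((x $ 2)\<^sup>2 + (x $ 3)\<^sup>2) < x $ 1}"

text \<open>The family is closed under differentiation in \<open>x\<close>: the exponent grows by one and the density is
  multiplied by \<open>\<langle>w, \<ell>(t)\<rangle>\<close>. All smoothness statements below rest on this, and it is the reason why
  \<open>k\<close> and \<open>\<psi>\<close> are kept general.\<close>

definition light_integral :: "nat \<Rightarrow> (real \<Rightarrow> 'b::banach) \<Rightarrow> real^3 \<Rightarrow> 'b" where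
  "light_integral k \<psi> x = integral {0..2 * pi} (\<lambda>t. inverse (- mink x (light t)) ^ k *\<^sub>R \<psi> t)"

lemma continuous_on_light [continuous_intros]: "continuous_on S light"
proof -
  have *: "light = (\<lambda>t. axis 1 1 + cos t *\<^sub>R axis 2 1 + sin t *\<^sub>R axis 3 1)"
    by (simp add: light_def fun_eq_iff vec_eq_iff forall_3 axis_def)
  show ?thesis
    unfolding * by (intro continuous_intros)
qed

lemma continuous_on_mink [continuous_intros]:
  "continuous_on S f \<Longrightarrow> continuous_on S g \<Longrightarrow> continuous_on S (\<lambda>x. mink (f x) (g x))"
  by (rule bounded_bilinear.continuous_on[OF mink_bounded_bilinear])

lemma mink_light: "mink x (light t) = - x $ 1 + x $ 2 * cos t + x $ 3 * sin t"
  by (simp add: mink_def light_def)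

lemma mink_light_light: "mink (light t) (light t) = 0"
  using sin_cos_squared_add[of t] by (simp add: mink_def light_def power2_eq_square)

lemma rotated_coordinate_le: "a * cos t + b * sin t \<le> sqrt (a\<^sup>2 + b\<^sup>2)"
proof -
  have "(a * cos t + b * sin t)\<^sup>2 + (a * sin t - b * cos t)\<^sup>2
      = (a\<^sup>2 + b\<^sup>2) * ((cos t)\<^sup>2 + (sin t)\<^sup>2)"
    by algebra
  moreover have "(a * sin t - b * cos t)\<^sup>2 \<ge> 0" by simp
  ultimately have "(a * cos t + b * sin t)\<^sup>2 \<le> a\<^sup>2 + b\<^sup>2"
    by (simp only: sin_cos_squared_add2 mult_1_right)
  then show ?thesis by (rule real_le_rsqrt)
qed

lemma future_cone_light: "x \<in> future_cone \<Longrightarrow> mink x (light t) < 0"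
  using rotated_coordinate_le[of "x $ 2" t "x $ 3"] by (simp add: future_cone_def mink_light)

lemma open_future_cone: "open future_cone"
  unfolding future_cone_def by (intro open_Collect_less continuous_intros)

lemma H2_subset_future_cone: "H2 \<subseteq> future_cone"
proof
  fix x assume "x \<in> H2"
  then have "(x $ 2)\<^sup>2 + (x $ 3)\<^sup>2 < (x $ 1)\<^sup>2" "x $ 1 > 0"
    by (auto simp: H2_def mink_def power2_eq_square)
  then show "x \<in> future_cone"
    unfolding future_cone_def by (simp add: real_less_lsqrt)
qed

lemma continuous_on_light_integral_integrand:
  fixes \<psi> :: "real \<Rightarrow> 'b::banach"
  assumes "continuous_on {0..2 * pi} \<psi>" "x \<in> future_cone"
  shows "continuous_on {0..2 * pi} (\<lambda>t. inverse (- mink x (light t)) ^ k *\<^sub>R \<psi> t)"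
proof -
  have nz: "mink x (light t) \<noteq> 0" for t using future_cone_light[OF assms(2), of t] by simp
  show ?thesis by (intro continuous_intros assms) (use nz in simp)
qed

lemma light_integral_integrable:
  fixes \<psi> :: "real \<Rightarrow> 'b::banach"
  assumes "continuous_on {0..2 * pi} \<psi>" "x \<in> future_cone"
  shows "(\<lambda>t. inverse (- mink x (light t)) ^ k *\<^sub>R \<psi> t) integrable_on {0..2 * pi}"
  by (intro integrable_continuous_interval continuous_on_light_integral_integrand assms)

lemma light_integral_add:
  assumes "continuous_on {0..2 * pi} \<psi>" "continuous_on {0..2 * pi} \<xi>" "x \<in> future_cone"
  shows "light_integral k (\<lambda>t. \<psi> t + \<xi> t) x = light_integral k \<psi> x + light_integral k \<xi> x"
  unfolding light_integral_def scaleR_add_right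
  by (intro integral_add light_integral_integrable assms)

lemma light_integral_linear:
  assumes "bounded_linear h" "continuous_on {0..2 * pi} \<psi>" "x \<in> future_cone"
  shows "h (light_integral k \<psi> x) = light_integral k (\<lambda>t. h (\<psi> t)) x"
  unfolding light_integral_def
  using integral_linear[OF light_integral_integrable[OF assms(2,3), of k] assms(1)]
  by (simp add: o_def linear_cmul[OF bounded_linear.linear[OF assms(1)]])

text \<open>Euler's relation for homogeneous functions: a density containing \<open>\<langle>x, \<ell>(t)\<rangle>\<close> at the base point
  \<open>x\<close> itself lowers the exponent again.\<close>

lemma light_integral_Suc_mink:
  assumes "x \<in> future_cone"
  shows "light_integral (Suc k) (\<lambda>t. mink x (light t) *\<^sub>R \<psi> t) x = - light_integral k \<psi> x"
proof -
  have "mink x (light t) \<noteq> 0" for t using future_cone_light[OF assms, of t] by simp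
  then have "inverse (- mink x (light t)) ^ Suc k *\<^sub>R mink x (light t) *\<^sub>R \<psi> t
      = - (inverse (- mink x (light t)) ^ k *\<^sub>R \<psi> t)" for t
    by (simp add: field_simps)
  then show ?thesis by (simp only: light_integral_def integral_neg)
qed

lemma light_integral_has_derivative:
  fixes \<psi> :: "real \<Rightarrow> 'b::banach"
  assumes \<psi>: "continuous_on {0..2 * pi} \<psi>" and x: "x \<in> future_cone"
  shows "(light_integral k \<psi> has_derivative
    (\<lambda>w. real k *\<^sub>R light_integral (Suc k) (\<lambda>t. mink w (light t) *\<^sub>R \<psi> t) x)) (at x)"
proof -
  obtain e where e: "e > 0" "ball x e \<subseteq> future_cone"
    using open_future_cone x open_contains_ball by blast
  define D where "D y t w =
    (real k * inverse (- mink y (light t)) ^ Suc k * mink w (light t)) *\<^sub>R \<psi> t" for y t w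
  have D: "bounded_linear (D y t)" for y t
    unfolding D_def
    by (intro bounded_linear_scaleR_const bounded_linear_const_mult
        bounded_bilinear.bounded_linear_left[OF mink_bounded_bilinear])
  have nz: "mink y (light t) \<noteq> 0" if "y \<in> ball x e" for y t
    using future_cone_light[of y t] e that by auto
  have deriv: "((\<lambda>y. inverse (- mink y (light t)) ^ k *\<^sub>R \<psi> t) has_derivative D y t) (at y within ball x e)"
    if y: "y \<in> ball x e" for y t
  proof -
    have "((\<lambda>y. - mink y (light t)) has_derivative (\<lambda>w. - mink w (light t))) (at y within ball x e)"
      by (intro bounded_linear_imp_has_derivative bounded_linear_minus
          bounded_bilinear.bounded_linear_left[OF mink_bounded_bilinear])
    moreover have "- mink y (light t) \<noteq> 0" using nz[OF y] by simp
    ultimately show ?thesis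
      by (intro has_derivative_eq_rhs[OF bounded_linear.has_derivative[OF bounded_linear_scaleR_left
              has_derivative_power[OF Deriv.has_derivative_inverse]]])
        (assumption | cases k; simp add: D_def fun_eq_iff mult_ac)+
  qed
  \<comment> \<open>Continuity of an operator-valued map is tested on each vector.\<close>
  have cont: "continuous_on (ball x e \<times> cbox 0 (2 * pi)) (\<lambda>(y, t). Blinfun (D y t))"
  proof (rule continuous_on_blinfun_componentwise)
    fix i :: "real^3"
    show "continuous_on (ball x e \<times> cbox 0 (2 * pi))
      (\<lambda>q. blinfun_apply (case q of (y, t) \<Rightarrow> Blinfun (D y t)) i)"
      unfolding split_beta bounded_linear_Blinfun_apply[OF D] D_def
      using nz
      by (intro continuous_intros continuous_on_compose2[OF continuous_on_light]
          continuous_on_compose2[OF \<psi>]) auto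
  qed
  have "((\<lambda>y. integral (cbox 0 (2 * pi)) (\<lambda>t. inverse (- mink y (light t)) ^ k *\<^sub>R \<psi> t))
    has_derivative integral (cbox 0 (2 * pi)) (\<lambda>t. Blinfun (D x t))) (at x within ball x e)"
    using e
    by (intro leibniz_rule[OF _ _ cont])
      (auto simp: bounded_linear_Blinfun_apply[OF D] deriv simp del: inverse_minus_eq
        intro!: light_integral_integrable \<psi>)
  moreover have "blinfun_apply (integral (cbox 0 (2 * pi)) (\<lambda>t. Blinfun (D x t))) w
      = real k *\<^sub>R light_integral (Suc k) (\<lambda>t. mink w (light t) *\<^sub>R \<psi> t) x" for w
  proof -
    have "continuous_on (cbox 0 (2 * pi)) (\<lambda>t. (x, t))"
      by (intro continuous_intros)
    from continuous_on_compose2[OF cont this] e(1)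
    have "continuous_on (cbox 0 (2 * pi)) (\<lambda>t. Blinfun (D x t))"
      by (simp add: image_subset_iff)
    from integral_linear[OF integrable_continuous[OF this] blinfun.bounded_linear_left[of w]]
    have "blinfun_apply (integral (cbox 0 (2 * pi)) (\<lambda>t. Blinfun (D x t))) w
        = integral (cbox 0 (2 * pi)) (\<lambda>t. D x t w)"
      by (simp add: o_def bounded_linear_Blinfun_apply[OF D])
    also have "\<dots> = real k *\<^sub>R light_integral (Suc k) (\<lambda>t. mink w (light t) *\<^sub>R \<psi> t) x"
      by (simp add: light_integral_def D_def integral_cmul[symmetric] mult.assoc del: integral_cmul power_Suc)
    finally show ?thesis .
  qed
  then have "blinfun_apply (integral (cbox 0 (2 * pi)) (\<lambda>t. Blinfun (D x t)))
      = (\<lambda>w. real k *\<^sub>R light_integral (Suc k) (\<lambda>t. mink w (light t) *\<^sub>R \<psi> t) x)"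
    by (rule ext)
  ultimately show ?thesis
    using e(1) by (simp only: light_integral_def[abs_def] at_within_open[OF _ open_ball] centre_in_ball cbox_interval)
qed

lemma differentiable_light_integral:
  fixes \<psi> :: "real \<Rightarrow> 'b::banach"
  assumes "continuous_on {0..2 * pi} \<psi>"
  shows "light_integral k \<psi> differentiable_on future_cone"
  unfolding differentiable_on_eq_differentiable_at[OF open_future_cone] differentiable_def
  using light_integral_has_derivative[OF assms] by blast

lemma Ck_on_light_integral:
  fixes \<psi> :: "real \<Rightarrow> 'b::banach"
  assumes "continuous_on {0..2 * pi} \<psi>"
  shows "Ck_on m future_cone (light_integral k \<psi>)"
  using assms
proof (induction m arbitrary: k \<psi>)
  case 0
  then show ?case
    by (simp add: differentiable_imp_continuous_on differentiable_light_integral)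
next
  case (Suc m)
  have "Ck_on m future_cone (\<lambda>x. frechet_derivative (light_integral k \<psi>) (at x) v)" for v
  proof (rule Ck_on_cong[OF open_future_cone])
    show "Ck_on m future_cone (\<lambda>x. real k *\<^sub>R light_integral (Suc k) (\<lambda>t. mink v (light t) *\<^sub>R \<psi> t) x)"
      by (intro Ck_on_linear[OF open_future_cone bounded_linear_scaleR_right] Suc.IH
          continuous_intros Suc.prems)
  qed (simp add: frechet_derivative_at[OF light_integral_has_derivative[OF Suc.prems], symmetric])
  then show ?case
    by (simp add: differentiable_light_integral Suc.prems)
qed

lemma linear_light_integral_mink:
  fixes \<psi> :: "real \<Rightarrow> 'b::banach"
  assumes "continuous_on {0..2 * pi} \<psi>" "x \<in> future_cone"
  shows "linear (\<lambda>w. light_integral (Suc k) (\<lambda>t. mink w (light t) *\<^sub>R \<psi> t) x)"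
  by (rule linearI)
    (simp_all add: mink_simps scaleR_add_left light_integral_add assms continuous_intros
      light_integral_linear[OF bounded_linear_scaleR_right])

section \<open>The vector field of a boundary density\<close>

text \<open>This is \<open>J grad u\<close> for \<open>u(x) = (1 / 2\<pi>) \<integral> \<phi>(t) \<langle>x, \<ell>(t)\<rangle>\<^sup>-\<^sup>2 dt\<close>: the ambient gradient of
  \<open>\<langle>x, \<ell>\<rangle>\<^sup>-\<^sup>2\<close> is \<open>2 (- \<langle>x, \<ell>\<rangle>)\<^sup>-\<^sup>3 \<ell>\<close>, and its component along \<open>x\<close> is lost in the product with
  \<open>x\<close>.\<close>

definition poisson_field :: "(real \<Rightarrow> real) \<Rightarrow> real^3 \<Rightarrow> real^3" where
  "poisson_field \<phi> x = (1 / pi) *\<^sub>R (x \<boxtimes> light_integral 3 (\<lambda>t. \<phi> t *\<^sub>R light t) x)"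

lemma vector_field_poisson_field:
  assumes "continuous_on {0..2 * pi} \<phi>"
  shows "vector_field H2 tangent_H2 (poisson_field \<phi>)"
proof -
  have "Ck_on k future_cone (poisson_field \<phi>)" for k
    unfolding poisson_field_def
    by (intro Ck_on_linear[OF open_future_cone bounded_linear_scaleR_right]
        Ck_on_bilinear[OF open_future_cone boxtimes_bounded_bilinear] Ck_on_id open_future_cone
        Ck_on_light_integral continuous_intros assms)
  then have "smooth_on H2 (poisson_field \<phi>)"
    unfolding smooth_on_def using open_future_cone H2_subset_future_cone by blast
  then show ?thesis
    by (simp add: vector_field_def tangent_H2_def poisson_field_def mink_simps mink_boxtimes_self)
qed

definition dpoisson_field :: "(real \<Rightarrow> real) \<Rightarrow> real^3 \<Rightarrow> real^3 \<Rightarrow> real^3" where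
  "dpoisson_field \<phi> x w = (1 / pi) *\<^sub>R (w \<boxtimes> light_integral 3 (\<lambda>t. \<phi> t *\<^sub>R light t) x
     + 3 *\<^sub>R (x \<boxtimes> light_integral 4 (\<lambda>t. mink w (light t) *\<^sub>R \<phi> t *\<^sub>R light t) x))"

definition ddpoisson_field :: "(real \<Rightarrow> real) \<Rightarrow> real^3 \<Rightarrow> real^3 \<Rightarrow> real^3 \<Rightarrow> real^3" where
  "ddpoisson_field \<phi> x w h = (1 / pi) *\<^sub>R (
     3 *\<^sub>R (w \<boxtimes> light_integral 4 (\<lambda>t. mink h (light t) *\<^sub>R \<phi> t *\<^sub>R light t) x)
     + 3 *\<^sub>R (h \<boxtimes> light_integral 4 (\<lambda>t. mink w (light t) *\<^sub>R \<phi> t *\<^sub>R light t) x)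
     + 12 *\<^sub>R (x \<boxtimes> light_integral 5 (\<lambda>t. mink h (light t) *\<^sub>R mink w (light t) *\<^sub>R \<phi> t *\<^sub>R light t) x))"

lemma poisson_field_has_derivative:
  assumes \<phi>: "continuous_on {0..2 * pi} \<phi>" and x: "x \<in> future_cone"
  shows "(poisson_field \<phi> has_derivative dpoisson_field \<phi> x) (at x)"
proof -
  have "(light_integral 3 (\<lambda>t. \<phi> t *\<^sub>R light t) has_derivative
      (\<lambda>w. 3 *\<^sub>R light_integral 4 (\<lambda>t. mink w (light t) *\<^sub>R \<phi> t *\<^sub>R light t) x)) (at x)"
    using light_integral_has_derivative[OF _ x, of "\<lambda>t. \<phi> t *\<^sub>R light t" 3] \<phi>
    by (simp add: continuous_intros)
  then show ?thesis
    unfolding poisson_field_def[abs_def] dpoisson_field_def[abs_def]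
    by (auto intro!: derivative_eq_intros bounded_bilinear.FDERIV[OF boxtimes_bounded_bilinear]
        simp: boxtimes_simps algebra_simps)
qed

lemma dpoisson_field_has_derivative:
  assumes \<phi>: "continuous_on {0..2 * pi} \<phi>" and x: "x \<in> future_cone"
  shows "((\<lambda>y. dpoisson_field \<phi> y w) has_derivative ddpoisson_field \<phi> x w) (at x)"
proof -
  have 1: "(light_integral 3 (\<lambda>t. \<phi> t *\<^sub>R light t) has_derivative
      (\<lambda>w. 3 *\<^sub>R light_integral 4 (\<lambda>t. mink w (light t) *\<^sub>R \<phi> t *\<^sub>R light t) x)) (at x)"
    using light_integral_has_derivative[OF _ x, of "\<lambda>t. \<phi> t *\<^sub>R light t" 3] \<phi>
    by (simp add: continuous_intros)
  have 2: "(light_integral 4 (\<lambda>t. mink w (light t) *\<^sub>R \<phi> t *\<^sub>R light t) has_derivative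
      (\<lambda>h. 4 *\<^sub>R light_integral 5 (\<lambda>t. mink h (light t) *\<^sub>R mink w (light t) *\<^sub>R \<phi> t *\<^sub>R light t) x)) (at x)"
    using light_integral_has_derivative[OF _ x, of "\<lambda>t. mink w (light t) *\<^sub>R \<phi> t *\<^sub>R light t" 4] \<phi>
    by (simp add: continuous_intros)
  show ?thesis
    unfolding dpoisson_field_def ddpoisson_field_def[abs_def]
    by (rule derivative_eq_intros bounded_bilinear.FDERIV[OF boxtimes_bounded_bilinear]
        bounded_linear.has_derivative[OF bounded_bilinear.bounded_linear_right[OF boxtimes_bounded_bilinear]]
        1 2 refl)+
     (simp add: boxtimes_simps algebra_simps)
qed

text \<open>Symmetry of \<open>\<langle>J a, V' b\<rangle>\<close> is visible from the integrand, in which \<open>a\<close> and \<open>b\<close> enter through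
  \<open>\<langle>a, b\<rangle>\<close> and \<open>\<langle>a, \<ell>\<rangle>\<langle>b, \<ell>\<rangle>\<close>. For the trace, the expansion of \<open>\<ell>\<close> in the frame \<open>a\<close>, \<open>b\<close>, \<open>x\<close>
  and the fact that \<open>\<ell>\<close> is light-like reduce each second-order term to a multiple of
  \<open>P = x \<boxtimes> \<integral> (- \<langle>x, \<ell>\<rangle>)\<^sup>-\<^sup>3 \<phi> \<ell>\<close>; the coefficients add up to \<open>- 6 + 12 - 4 = 2\<close>.\<close>

lemma harmonic_lagrangian_poisson_field:
  assumes \<phi>: "continuous_on {0..2 * pi} \<phi>"
  shows "harmonic_lagrangian (poisson_field \<phi>)"
proof -
  note V = vector_field_poisson_field[OF \<phi>]
  note cone = H2_subset_future_cone[THEN subsetD]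
  note dV = poisson_field_has_derivative[OF \<phi> cone]
  note cont = continuous_intros \<phi>
  define L where "L = (\<lambda>t. \<phi> t *\<^sub>R light t)"
  have L: "continuous_on {0..2 * pi} L" unfolding L_def by (intro cont)
  have cL: "continuous_on {0..2 * pi} (\<lambda>t. mink w (light t) *\<^sub>R L t)" for w
    by (intro continuous_intros L)
  have "lagrangian_field (poisson_field \<phi>)"
  proof (rule lagrangian_fieldI[OF V dV])
    fix x a b assume x: "x \<in> H2" and a: "mink x a = 0" and b: "mink x b = 0"
    have 4: "mink u (light_integral 4 (\<lambda>t. mink w (light t) *\<^sub>R L t) x) =
        light_integral 4 (\<lambda>t. mink w (light t) * (\<phi> t * mink u (light t))) x" for u w
      by (subst light_integral_linear[OF bounded_bilinear.bounded_linear_right[OF mink_bounded_bilinear] _ cone[OF x]])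
        (auto intro!: cont L simp: mink_simps L_def mult.assoc)
    have d: "dpoisson_field \<phi> x w = (1 / pi) *\<^sub>R (w \<boxtimes> light_integral 3 L x
        + 3 *\<^sub>R (x \<boxtimes> light_integral 4 (\<lambda>t. mink w (light t) *\<^sub>R L t) x))" for w
      by (simp add: dpoisson_field_def L_def)
    have "mink (x \<boxtimes> u) (dpoisson_field \<phi> x w) = (1 / pi) * (mink x (light_integral 3 L x) * mink u w
        + 3 * light_integral 4 (\<lambda>t. mink w (light t) * (\<phi> t * mink u (light t))) x)"
      if "mink x u = 0" "mink x w = 0" for u w
      using that x mink_commute[of u x] mink_commute[of w x]
      by (simp add: d mink_simps mink_boxtimes_boxtimes 4 H2_def)
    from this[OF a b] this[OF b a]
    show "mink (x \<boxtimes> a) (dpoisson_field \<phi> x b) = mink (x \<boxtimes> b) (dpoisson_field \<phi> x a)"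
      by (simp add: mink_commute[of a b] mult.left_commute mult.commute)
  qed
  moreover have "harmonic_field (poisson_field \<phi>)"
  proof (rule harmonic_fieldI[OF V dV dpoisson_field_has_derivative[OF \<phi> cone]])
    fix x h assume x: "x \<in> H2"
    have 4: "linear (\<lambda>w. light_integral 4 (\<lambda>t. mink w (light t) *\<^sub>R L t) x)"
      using linear_light_integral_mink[OF L cone[OF x], of 3] by simp
    have 5: "linear (\<lambda>w. light_integral 5 (\<lambda>t. mink h (light t) *\<^sub>R mink w (light t) *\<^sub>R L t) x)"
      using linear_light_integral_mink[OF cL[of h] cone[OF x], of 4]
      by (simp add: mult.commute)
    define P4 P5 where "P4 w = light_integral 4 (\<lambda>t. mink w (light t) *\<^sub>R L t) x"
      and "P5 w = light_integral 5 (\<lambda>t. mink h (light t) *\<^sub>R mink w (light t) *\<^sub>R L t) x" for w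
    have lin: "linear P4" "linear P5"
      using 4 5 by (simp_all add: P4_def[abs_def] P5_def[abs_def])
    have "ddpoisson_field \<phi> x w h = (1 / pi) *\<^sub>R
        (3 *\<^sub>R (w \<boxtimes> P4 h) + 3 *\<^sub>R (h \<boxtimes> P4 w) + 12 *\<^sub>R (x \<boxtimes> P5 w))" for w
      by (simp add: ddpoisson_field_def P4_def P5_def L_def)
    then show "linear (\<lambda>w. ddpoisson_field \<phi> x w h)"
      by (intro linearI) (simp_all add: linear_add[OF lin(1)] linear_cmul[OF lin(1)]
          linear_add[OF lin(2)] linear_cmul[OF lin(2)] boxtimes_simps algebra_simps)
  next
    fix x a b
    assume x: "x \<in> H2" and o: "mink x a = 0" "mink x b = 0" "mink a a = 1" "mink b b = 1" "mink a b = 0"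
    note e = orthonormal_expansion[OF x o]
    let ?P = "x \<boxtimes> light_integral 3 L x"
    have bl: "w \<boxtimes> light_integral k \<psi> x = light_integral k (\<lambda>t. w \<boxtimes> \<psi> t) x"
      if "continuous_on {0..2 * pi} \<psi>" for w k \<psi>
      by (rule light_integral_linear[OF bounded_bilinear.bounded_linear_right[OF boxtimes_bounded_bilinear] that cone[OF x]])
    have LL: "light t \<boxtimes> L t = 0" for t
      by (simp add: L_def boxtimes_explicit vec_eq_iff forall_3 light_def)
    have "a \<boxtimes> light_integral 4 (\<lambda>t. mink a (light t) *\<^sub>R L t) x + b \<boxtimes> light_integral 4 (\<lambda>t. mink b (light t) *\<^sub>R L t) x
      = light_integral 4 (\<lambda>t. (mink a (light t) *\<^sub>R a + mink b (light t) *\<^sub>R b) \<boxtimes> L t) x"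
      unfolding bl[OF cL]
      by (subst light_integral_add[symmetric])
        (auto intro!: bounded_bilinear.continuous_on[OF boxtimes_bounded_bilinear] L
          continuous_on_scaleR continuous_on_mink continuous_on_light continuous_on_const cone[OF x]
          simp: boxtimes_simps)
    also have "\<dots> = light_integral (Suc 3) (\<lambda>t. mink x (light t) *\<^sub>R (x \<boxtimes> L t)) x"
      by (simp add: e boxtimes_simps LL)
    also have "\<dots> = - ?P"
      by (simp only: light_integral_Suc_mink[OF cone[OF x]] bl[OF L])
    finally have 4: "a \<boxtimes> light_integral 4 (\<lambda>t. mink a (light t) *\<^sub>R L t) x
      + b \<boxtimes> light_integral 4 (\<lambda>t. mink b (light t) *\<^sub>R L t) x = - ?P" .
    have sq: "mink a (light t) * mink a (light t) + mink b (light t) * mink b (light t) =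
        mink x (light t) * mink x (light t)" for t
      using arg_cong[OF e[of "light t"], of "\<lambda>u. mink u (light t)"]
      by (simp add: mink_simps mink_light_light)
    have "light_integral 5 (\<lambda>t. mink a (light t) *\<^sub>R mink a (light t) *\<^sub>R L t) x
      + light_integral 5 (\<lambda>t. mink b (light t) *\<^sub>R mink b (light t) *\<^sub>R L t) x
      = light_integral 5 (\<lambda>t. (mink a (light t) * mink a (light t) + mink b (light t) * mink b (light t)) *\<^sub>R L t) x"
      by (subst light_integral_add[symmetric])
        (auto intro!: continuous_on_scaleR continuous_on_mult continuous_on_mink continuous_on_light
          continuous_on_const L cone[OF x] simp: scaleR_add_left)
    also have "\<dots> = light_integral (Suc 4) (\<lambda>t. mink x (light t) *\<^sub>R mink x (light t) *\<^sub>R L t) x"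
      by (simp add: sq)
    also have "\<dots> = - light_integral (Suc 3) (\<lambda>t. mink x (light t) *\<^sub>R L t) x"
      by (subst light_integral_Suc_mink[OF cone[OF x]]) simp
    also have "\<dots> = light_integral 3 L x"
      by (subst light_integral_Suc_mink[OF cone[OF x]]) simp
    finally have 5: "x \<boxtimes> light_integral 5 (\<lambda>t. mink a (light t) *\<^sub>R mink a (light t) *\<^sub>R L t) x
      + x \<boxtimes> light_integral 5 (\<lambda>t. mink b (light t) *\<^sub>R mink b (light t) *\<^sub>R L t) x = ?P"
      by (simp add: boxtimes_simps(2)[symmetric])
    have 3: "x \<boxtimes> light_integral 4 (\<lambda>t. mink x (light t) *\<^sub>R L t) x = - ?P"
      using light_integral_Suc_mink[OF cone[OF x], of 3 L] boxtimes_simps(4)[of x "-1" "light_integral 3 L x"] by simp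
    define A B where "A w = w \<boxtimes> light_integral 4 (\<lambda>t. mink w (light t) *\<^sub>R L t) x"
      and "B w = x \<boxtimes> light_integral 5 (\<lambda>t. mink w (light t) *\<^sub>R mink w (light t) *\<^sub>R L t) x" for w
    have dd: "ddpoisson_field \<phi> x w w = (1 / pi) *\<^sub>R (6 *\<^sub>R A w + 12 *\<^sub>R B w)" for w
      unfolding ddpoisson_field_def A_def B_def L_def
      by (simp add: scaleR_left_distrib[symmetric])
    have d: "dpoisson_field \<phi> x x = (1 / pi) *\<^sub>R (?P + 3 *\<^sub>R (- ?P))"
      using 3 by (simp only: dpoisson_field_def L_def)
    have AB: "A b = - ?P - A a" "B b = ?P - B a"
      using 4 5 by (simp_all add: A_def B_def algebra_simps)
    have "ddpoisson_field \<phi> x a a + ddpoisson_field \<phi> x b b + 2 *\<^sub>R dpoisson_field \<phi> x x =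
      (1 / pi) *\<^sub>R (6 *\<^sub>R (- ?P) + 12 *\<^sub>R ?P + 2 *\<^sub>R (?P + 3 *\<^sub>R (- ?P)))"
      unfolding dd d AB by (simp add: vec_eq_iff field_simps)
    also have "\<dots> = 2 *\<^sub>R poisson_field \<phi> x"
      unfolding poisson_field_def L_def[symmetric] by (simp add: algebra_simps)
    finally show "ddpoisson_field \<phi> x a a + ddpoisson_field \<phi> x b b + 2 *\<^sub>R dpoisson_field \<phi> x x =
      2 *\<^sub>R poisson_field \<phi> x" .
  qed
  ultimately show ?thesis
    using V by (simp add: harmonic_lagrangian_def)
qed

section \<open>The Klein model\<close>

definition unit_point :: "real \<Rightarrow> real^2" where
  "unit_point t = vector [cos t, sin t]"

text \<open>In complex notation, \<open>unit_point t\<close> is \<open>e\<^sup>i\<^sup>t\<close> and \<open>quarter_turn\<close> is multiplication by \<open>i\<close>.\<close>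

definition quarter_turn :: "real^2 \<Rightarrow> real^2" where
  "quarter_turn v = vector [- v $ 2, v $ 1]"

definition affine_lift :: "real^2 \<Rightarrow> real^3" where
  "affine_lift \<eta> = vector [1, \<eta> $ 1, \<eta> $ 2]"

text \<open>The point of \<open>H2\<close> over \<open>\<eta>\<close> is \<open>(1, \<eta>) / rho \<eta>\<close>.\<close>

definition rho :: "real^2 \<Rightarrow> real" where
  "rho \<eta> = sqrt (1 - (norm \<eta>)\<^sup>2)"

lemma inner_2: "x \<bullet> y = x $ 1 * y $ 1 + x $ 2 * (y :: real^2) $ 2"
  by (simp add: inner_vec_def sum_2)

lemma norm_2_sq: "(norm (x :: real^2))\<^sup>2 = (x $ 1)\<^sup>2 + (x $ 2)\<^sup>2"
  unfolding dot_square_norm[symmetric] by (simp add: inner_2 power2_eq_square)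

lemma linear_quarter_turn: "linear quarter_turn"
  by (rule linearI) (simp_all add: quarter_turn_def vec_eq_iff forall_2)

lemma bounded_linear_quarter_turn: "bounded_linear quarter_turn"
  using linear_quarter_turn by (simp add: linear_conv_bounded_linear)

lemma norm_quarter_turn: "norm (quarter_turn v) = norm v"
proof -
  have "(norm (quarter_turn v))\<^sup>2 = (norm v)\<^sup>2"
    unfolding norm_2_sq by (simp add: quarter_turn_def)
  then show ?thesis by simp
qed

lemma norm_unit_point [simp]: "norm (unit_point t) = 1"
proof -
  have "(norm (unit_point t))\<^sup>2 = 1"
    unfolding norm_2_sq by (simp add: unit_point_def)
  then show ?thesis by (simp add: power2_eq_1_iff) (smt (verit) norm_ge_zero)
qed

lemma unit_point_vector_derivative: "(unit_point has_vector_derivative quarter_turn (unit_point t)) (at t within S)"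
proof -
  have *: "unit_point = (\<lambda>t. cos t *\<^sub>R axis 1 1 + sin t *\<^sub>R axis 2 1)"
    by (simp add: unit_point_def fun_eq_iff vec_eq_iff forall_2 axis_def)
  have **: "quarter_turn (unit_point t) = (- sin t) *\<^sub>R axis 1 1 + cos t *\<^sub>R axis 2 1"
    by (simp add: unit_point_def quarter_turn_def vec_eq_iff forall_2 axis_def)
  show ?thesis
    unfolding ** unfolding * by (auto intro!: derivative_eq_intros)
qed

lemma continuous_on_unit_point [continuous_intros]: "continuous_on S unit_point"
  using has_vector_derivative_continuous[OF unit_point_vector_derivative]
  by (simp add: continuous_on_eq_continuous_within)

lemma continuous_on_quarter_turn [continuous_intros]:
  "continuous_on S f \<Longrightarrow> continuous_on S (\<lambda>x. quarter_turn (f x))"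
  by (rule bounded_linear.continuous_on[OF bounded_linear_quarter_turn])

lemma ball_norm_sq:
  assumes "\<eta> \<in> ball (0 :: real^2) 1" shows "(norm \<eta>)\<^sup>2 < 1"
  using assms by (simp add: abs_square_less_1)

lemma rho_pos: "\<eta> \<in> ball 0 1 \<Longrightarrow> rho \<eta> > 0"
  using ball_norm_sq[of \<eta>] by (simp add: rho_def)

lemma rho_sq: "\<eta> \<in> ball 0 1 \<Longrightarrow> (rho \<eta>)\<^sup>2 = 1 - (norm \<eta>)\<^sup>2"
  using ball_norm_sq[of \<eta>] by (simp add: rho_def)

lemma mink_affine_lift_light: "mink (affine_lift \<eta>) (light t) = \<eta> \<bullet> unit_point t - 1"
  by (simp add: mink_light affine_lift_def inner_2 unit_point_def)

lemma affine_lift_future_cone: "\<eta> \<in> ball 0 1 \<Longrightarrow> affine_lift \<eta> \<in> future_cone"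
  using ball_norm_sq[of \<eta>] by (simp add: future_cone_def affine_lift_def norm_2_sq)

lemma one_minus_inner_unit_point_ge: "1 - norm \<eta> \<le> 1 - \<eta> \<bullet> unit_point t"
  using norm_cauchy_schwarz[of \<eta> "unit_point t"] by simp

lemma Klein_inv_eq:
  assumes "\<eta> \<in> ball 0 1"
  shows "Klein_inv \<eta> = inverse (rho \<eta>) *\<^sub>R affine_lift \<eta>" "Klein_inv \<eta> \<in> H2"
proof -
  let ?x = "inverse (rho \<eta>) *\<^sub>R affine_lift \<eta>"
  have "mink (affine_lift \<eta>) (affine_lift \<eta>) = - (rho \<eta>)\<^sup>2"
    unfolding rho_sq[OF assms] norm_2_sq by (simp add: mink_def affine_lift_def power2_eq_square)
  then have x: "?x \<in> H2"
    using rho_pos[OF assms] by (simp add: H2_def mink_simps field_simps power2_eq_square) (simp add: affine_lift_def)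
  moreover have "Klein ?x = \<eta>"
    using rho_pos[OF assms] by (simp add: Klein_def affine_lift_def vec_eq_iff forall_2)
  moreover have "inj_on Klein H2"
  proof (rule inj_onI)
    fix x y assume x: "x \<in> H2" and y: "y \<in> H2" and eq: "Klein x = Klein y"
    have pos: "x $ 1 > 0" "y $ 1 > 0" using x y by (auto simp: H2_def)
    define k where "k = x $ 1 / y $ 1"
    have k: "k > 0" "x $ 1 = k * y $ 1" using pos by (auto simp: k_def)
    moreover have "x $ 2 = k * y $ 2" "x $ 3 = k * y $ 3"
      using eq pos by (auto simp: Klein_def k_def vec_eq_iff forall_2 field_simps)
    ultimately have xy: "x = k *\<^sub>R y" by (simp add: vec_eq_iff forall_3)
    then have "k * k = 1" using x y by (simp add: H2_def mink_simps)
    then have "k = 1" using k(1) by (simp add: square_eq_1_iff)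
    then show "x = y" using xy by simp
  qed
  ultimately show "Klein_inv \<eta> = ?x"
    unfolding Klein_inv_def by (metis inv_into_f_f)
  then show "Klein_inv \<eta> \<in> H2" using x by simp
qed

definition dKlein :: "real^3 \<Rightarrow> real^3 \<Rightarrow> real^2" where
  "dKlein x v = vector [v $ 2 / x $ 1 - x $ 2 * v $ 1 / (x $ 1)\<^sup>2,
                        v $ 3 / x $ 1 - x $ 3 * v $ 1 / (x $ 1)\<^sup>2]"

lemma Klein_has_derivative:
  assumes "x $ 1 \<noteq> 0"
  shows "(Klein has_derivative dKlein x) (at x within S)"
proof -
  have *: "Klein = (\<lambda>x. (x $ 2 / x $ 1) *\<^sub>R axis 1 1 + (x $ 3 / x $ 1) *\<^sub>R axis 2 1)"
    by (simp add: Klein_def fun_eq_iff vec_eq_iff forall_2 axis_def)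
  have c: "((\<lambda>x. x $ i) has_derivative (\<lambda>v. v $ i)) (at x within S)" for i :: 3
    by (rule bounded_linear_imp_has_derivative[OF bounded_linear_vec_nth])
  show ?thesis
    unfolding *
    by (rule derivative_eq_intros c refl assms)+
      (use assms in \<open>simp add: dKlein_def fun_eq_iff vec_eq_iff forall_2 axis_def field_simps power2_eq_square\<close>)
qed

lemma bounded_linear_dKlein: "bounded_linear (dKlein x)"
  unfolding linear_conv_bounded_linear[symmetric]
  by (rule linearI)
    (simp_all add: dKlein_def vec_eq_iff forall_2 add_divide_distrib algebra_simps)

text \<open>The image of \<open>x \<boxtimes> \<ell>(t)\<close> in the Klein model, up to the power of \<open>rho\<close> that comes from replacing \<open>x\<close>
  by the proportional vector \<open>(1, \<eta>)\<close>.\<close>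

definition boundary_kernel :: "real^2 \<Rightarrow> real \<Rightarrow> real^2" where
  "boundary_kernel \<eta> t =
     (rho \<eta>) ^ 3 *\<^sub>R quarter_turn ((rho \<eta>)\<^sup>2 *\<^sub>R unit_point t + mink (affine_lift \<eta>) (light t) *\<^sub>R \<eta>)"

lemma dKlein_boxtimes_light:
  assumes "\<eta> \<in> ball 0 1" "x = inverse (rho \<eta>) *\<^sub>R affine_lift \<eta>"
  shows "dKlein x (x \<boxtimes> light t) = quarter_turn ((rho \<eta>)\<^sup>2 *\<^sub>R unit_point t + mink (affine_lift \<eta>) (light t) *\<^sub>R \<eta>)"
proof -
  have [simp]: "rho \<eta> \<noteq> 0" using rho_pos[OF assms(1)] by simp
  show ?thesis
    unfolding rho_sq[OF assms(1)] norm_2_sq mink_affine_lift_light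
    by (simp add: assms(2) dKlein_def boxtimes_explicit affine_lift_def light_def quarter_turn_def unit_point_def
        vec_eq_iff forall_2 inner_2 field_simps power2_eq_square)
qed

lemma continuous_on_boundary_kernel: "continuous_on S (boundary_kernel \<eta>)"
  unfolding boundary_kernel_def[abs_def] by (intro continuous_intros)

lemma Klein_push_poisson_field:
  assumes \<phi>: "continuous_on {0..2 * pi} \<phi>" and \<eta>: "\<eta> \<in> ball 0 1"
  shows "Klein_push (poisson_field \<phi>) \<eta> =
    (1 / pi) *\<^sub>R light_integral 3 (\<lambda>t. \<phi> t *\<^sub>R boundary_kernel \<eta> t) (affine_lift \<eta>)"
proof -
  define x where "x = Klein_inv \<eta>"
  have x: "x = inverse (rho \<eta>) *\<^sub>R affine_lift \<eta>" "x \<in> H2"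
    using Klein_inv_eq[OF \<eta>] by (simp_all add: x_def)
  have c: "x \<in> future_cone" using x(2) H2_subset_future_cone by blast
  have L: "continuous_on {0..2 * pi} (\<lambda>t. \<phi> t *\<^sub>R light t)"
    by (intro continuous_intros \<phi>)
  have "Klein_push (poisson_field \<phi>) \<eta> = diff_on H2 Klein x (poisson_field \<phi> x)"
    by (simp add: Klein_push_def x_def)
  also have "\<dots> = dKlein x (poisson_field \<phi> x)"
    using x(2) vector_field_poisson_field[OF \<phi>]
    by (intro H2_diff_onI Klein_has_derivative) (auto simp: H2_def vector_field_def)
  also have "\<dots> = (1 / pi) *\<^sub>R dKlein x (x \<boxtimes> light_integral 3 (\<lambda>t. \<phi> t *\<^sub>R light t) x)"
    by (simp add: poisson_field_def linear_cmul[OF bounded_linear.linear[OF bounded_linear_dKlein]])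
  also have "dKlein x (x \<boxtimes> light_integral 3 (\<lambda>t. \<phi> t *\<^sub>R light t) x)
      = light_integral 3 (\<lambda>t. dKlein x (x \<boxtimes> (\<phi> t *\<^sub>R light t))) x"
    by (rule light_integral_linear[OF bounded_linear_compose[OF bounded_linear_dKlein
            bounded_bilinear.bounded_linear_right[OF boxtimes_bounded_bilinear]] L c])
  also have "\<dots> = light_integral 3 (\<lambda>t. \<phi> t *\<^sub>R quarter_turn ((rho \<eta>)\<^sup>2 *\<^sub>R unit_point t + mink (affine_lift \<eta>) (light t) *\<^sub>R \<eta>)) x"
    by (simp add: boxtimes_simps linear_cmul[OF bounded_linear.linear[OF bounded_linear_dKlein]]
        dKlein_boxtimes_light[OF \<eta> x(1)])
  also have "\<dots> = light_integral 3 (\<lambda>t. \<phi> t *\<^sub>R boundary_kernel \<eta> t) (affine_lift \<eta>)"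
    unfolding light_integral_def
    by (rule arg_cong[where f = "integral _"])
      (simp add: x(1) mink_simps boundary_kernel_def power_mult_distrib mult_ac fun_eq_iff)
  finally show ?thesis .
qed

section \<open>The mass of the boundary kernel\<close>

text \<open>The integral over the circle of the derivative of \<open>(1 - \<langle>\<eta>, e\<rangle>)\<^sup>-\<^sup>k i e\<close> with \<open>e = e\<^sup>i\<^sup>t\<close> vanishes;
  the factor \<open>\<langle>\<eta>, i e\<rangle> i e\<close> in that derivative is \<open>\<eta> - \<langle>\<eta>, e\<rangle> e\<close>. This recursion for the moments
  replaces an explicit evaluation of the integrals.\<close>

lemma light_integral_unit_point_Suc:
  assumes \<eta>: "\<eta> \<in> ball 0 1"
  shows "real k *\<^sub>R light_integral (Suc k) unit_point (affine_lift \<eta>) =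
    (real k * light_integral (Suc k) (\<lambda>_. 1) (affine_lift \<eta>)) *\<^sub>R \<eta> + (real k - 1) *\<^sub>R light_integral k unit_point (affine_lift \<eta>)"
proof -
  define s where "s t = 1 - \<eta> \<bullet> unit_point t" for t
  have s: "s t = - mink (affine_lift \<eta>) (light t)" for t by (simp add: s_def mink_affine_lift_light)
  have pos: "s t > 0" for t
    using future_cone_light[OF affine_lift_future_cone[OF \<eta>], of t] by (simp add: s)
  define F where "F t = inverse (s t) ^ k *\<^sub>R quarter_turn (unit_point t)" for t
  define F' where "F' t = (real k * inverse (s t) ^ Suc k) *\<^sub>R \<eta>
     - real k *\<^sub>R (inverse (s t) ^ Suc k *\<^sub>R unit_point t) + (real k - 1) *\<^sub>R (inverse (s t) ^ k *\<^sub>R unit_point t)" for t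
  have "(F has_vector_derivative F' t) (at t within {0..2 * pi})" for t
  proof -
    have "(s has_real_derivative - (\<eta> \<bullet> quarter_turn (unit_point t))) (at t within {0..2 * pi})"
      unfolding s_def has_real_derivative_iff_has_vector_derivative
      by (auto intro!: derivative_eq_intros
          bounded_linear.has_vector_derivative[OF bounded_linear_inner_right unit_point_vector_derivative])
    then have "((\<lambda>t. inverse (s t) ^ k) has_real_derivative
        real k * inverse (s t) ^ Suc k * (\<eta> \<bullet> quarter_turn (unit_point t))) (at t within {0..2 * pi})"
      using pos[of t]
      by (intro DERIV_cong[OF DERIV_power[OF DERIV_inverse_fun]])
        (assumption | simp | cases k; simp add: power_inverse[symmetric] power2_eq_square mult_ac)+
    moreover have "((\<lambda>t. quarter_turn (unit_point t)) has_vector_derivative quarter_turn (quarter_turn (unit_point t))) (at t within {0..2 * pi})"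
      by (rule bounded_linear.has_vector_derivative[OF bounded_linear_quarter_turn unit_point_vector_derivative])
    ultimately have "(F has_vector_derivative
        inverse (s t) ^ k *\<^sub>R quarter_turn (quarter_turn (unit_point t)) +
        (real k * inverse (s t) ^ Suc k * (\<eta> \<bullet> quarter_turn (unit_point t))) *\<^sub>R quarter_turn (unit_point t)) (at t within {0..2 * pi})"
      unfolding F_def
      by (rule has_vector_derivative_scaleR)
    moreover have "quarter_turn (quarter_turn (unit_point t)) = - unit_point t"
      by (simp add: quarter_turn_def vec_eq_iff forall_2)
    moreover have tangential: "(\<eta> \<bullet> quarter_turn (unit_point t)) *\<^sub>R quarter_turn (unit_point t) = \<eta> - (1 - s t) *\<^sub>R unit_point t"
    proof -
      have 1: "(cos t)\<^sup>2 + (sin t)\<^sup>2 = 1" by simp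
      show ?thesis
        unfolding s_def
        by (simp add: inner_2 quarter_turn_def unit_point_def vec_eq_iff forall_2)
          (intro conjI; use 1 in algebra)
    qed
    have "(a * (\<eta> \<bullet> quarter_turn (unit_point t))) *\<^sub>R quarter_turn (unit_point t) = a *\<^sub>R \<eta> - a *\<^sub>R unit_point t + (a * s t) *\<^sub>R unit_point t" for a
      by (simp only: scaleR_scaleR[symmetric] tangential) (simp add: algebra_simps)
    moreover have "(real k * inverse (s t) ^ Suc k) * s t = real k * inverse (s t) ^ k"
      using pos[of t] by simp
    moreover have "F' t = inverse (s t) ^ k *\<^sub>R (- unit_point t) + ((real k * inverse (s t) ^ Suc k) *\<^sub>R \<eta>
        - (real k * inverse (s t) ^ Suc k) *\<^sub>R unit_point t + (real k * inverse (s t) ^ k) *\<^sub>R unit_point t)"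
      by (simp add: F'_def algebra_simps del: power_Suc)
    ultimately show ?thesis by (simp only:)
  qed
  then have "(F' has_integral F (2 * pi) - F 0) {0..2 * pi}"
    by (intro fundamental_theorem_of_calculus) simp_all
  moreover have "F (2 * pi) - F 0 = 0" by (simp add: F_def s_def unit_point_def)
  ultimately have 0: "(F' has_integral 0) {0..2 * pi}" by simp
  have I: "((\<lambda>t. inverse (s t) ^ j *\<^sub>R \<psi> t) has_integral light_integral j \<psi> (affine_lift \<eta>)) {0..2 * pi}"
    if "continuous_on {0..2 * pi} \<psi>" for j and \<psi> :: "real \<Rightarrow> 'b::banach"
    unfolding light_integral_def s
    by (intro integrable_integral light_integral_integrable that affine_lift_future_cone \<eta>)
  have "((\<lambda>t. (real k * inverse (s t) ^ Suc k) *\<^sub>R \<eta>) has_integral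
      (real k * light_integral (Suc k) (\<lambda>_. 1) (affine_lift \<eta>)) *\<^sub>R \<eta>) {0..2 * pi}"
    using has_integral_mult_right[OF I[of "\<lambda>_. 1 :: real" "Suc k"], of "real k"]
    by (intro has_integral_scaleR_left) simp
  then have "(F' has_integral (real k * light_integral (Suc k) (\<lambda>_. 1) (affine_lift \<eta>)) *\<^sub>R \<eta>
      - real k *\<^sub>R light_integral (Suc k) unit_point (affine_lift \<eta>) + (real k - 1) *\<^sub>R light_integral k unit_point (affine_lift \<eta>)) {0..2 * pi}"
    unfolding F'_def
    by (intro has_integral_add has_integral_diff has_integral_cmul I continuous_intros)
  from has_integral_unique[OF 0 this] show ?thesis by (simp add: algebra_simps)
qed

text \<open>Because \<open>\<langle>\<eta>, e\<rangle> = 1 - (1 - \<langle>\<eta>, e\<rangle>)\<close>.\<close>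

lemma inner_light_integral_unit_point:
  assumes \<eta>: "\<eta> \<in> ball 0 1"
  shows "\<eta> \<bullet> light_integral (Suc k) unit_point (affine_lift \<eta>) =
    light_integral (Suc k) (\<lambda>_. 1) (affine_lift \<eta>) - light_integral k (\<lambda>_. 1) (affine_lift \<eta>)"
proof -
  note c = affine_lift_future_cone[OF \<eta>]
  have "\<eta> \<bullet> light_integral (Suc k) unit_point (affine_lift \<eta>) = light_integral (Suc k) (\<lambda>t. \<eta> \<bullet> unit_point t) (affine_lift \<eta>)"
    by (intro light_integral_linear bounded_linear_inner_right c continuous_intros)
  also have "\<dots> = light_integral (Suc k) (\<lambda>t. 1 + mink (affine_lift \<eta>) (light t) *\<^sub>R 1) (affine_lift \<eta>)"
    by (simp add: mink_affine_lift_light)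
  also have "\<dots> = light_integral (Suc k) (\<lambda>_. 1) (affine_lift \<eta>)
      + light_integral (Suc k) (\<lambda>t. mink (affine_lift \<eta>) (light t) *\<^sub>R 1) (affine_lift \<eta>)"
    by (intro light_integral_add c continuous_intros)
  finally show ?thesis by (simp add: light_integral_Suc_mink[OF c] del: real_scaleR_def)
qed

text \<open>The recursion for \<open>k = 1\<close> and \<open>k = 2\<close>, together with its inner products with \<open>\<eta>\<close>, expresses the
  integrals that occur below by the scalar one with exponent 2.\<close>

lemma light_integral_one_relations:
  assumes \<eta>: "\<eta> \<in> ball 0 1"
  shows "light_integral 2 unit_point (affine_lift \<eta>) = light_integral 2 (\<lambda>_. 1) (affine_lift \<eta>) *\<^sub>R \<eta>"
    and "light_integral 1 (\<lambda>_. 1) (affine_lift \<eta>) = (rho \<eta>)\<^sup>2 * light_integral 2 (\<lambda>_. 1) (affine_lift \<eta>)"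
    and "(rho \<eta>)\<^sup>2 *\<^sub>R light_integral 3 unit_point (affine_lift \<eta>) = (3 / 2 * light_integral 2 (\<lambda>_. 1) (affine_lift \<eta>)) *\<^sub>R \<eta>"
proof -
  let ?I = "\<lambda>k. light_integral k (\<lambda>_. 1 :: real) (affine_lift \<eta>)" and ?C = "\<lambda>k. light_integral k unit_point (affine_lift \<eta>)"
  show 1: "?C 2 = ?I 2 *\<^sub>R \<eta>"
    using light_integral_unit_point_Suc[OF \<eta>, of 1] by (simp add: numeral_2_eq_2)
  have r: "(norm \<eta>)\<^sup>2 = 1 - (rho \<eta>)\<^sup>2" using rho_sq[OF \<eta>] by simp
  have "?I 2 * (norm \<eta>)\<^sup>2 = ?I 2 - ?I 1"
    using inner_light_integral_unit_point[OF \<eta>, of 1] 1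
    by (simp add: numeral_2_eq_2 dot_square_norm)
  then show "?I 1 = (rho \<eta>)\<^sup>2 * ?I 2" by (simp add: r algebra_simps)
  have 3: "?C 3 = (?I 3 + ?I 2 / 2) *\<^sub>R \<eta>"
  proof -
    have "2 *\<^sub>R ?C 3 = (2 * ?I 3) *\<^sub>R \<eta> + ?C 2"
      using light_integral_unit_point_Suc[OF \<eta>, of 2] by (simp add: numeral_3_eq_3 numeral_2_eq_2)
    then have "(1 / 2) *\<^sub>R 2 *\<^sub>R ?C 3 = (1 / 2) *\<^sub>R ((2 * ?I 3) *\<^sub>R \<eta> + ?I 2 *\<^sub>R \<eta>)"
      by (simp only: 1)
    then show ?thesis by (simp add: algebra_simps)
  qed
  have "(?I 3 + ?I 2 / 2) * (norm \<eta>)\<^sup>2 = ?I 3 - ?I 2"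
    using inner_light_integral_unit_point[OF \<eta>, of 2] 3
    by (simp add: numeral_3_eq_3 numeral_2_eq_2 dot_square_norm)
  then have "(?I 3 + ?I 2 / 2) - (?I 3 + ?I 2 / 2) * (rho \<eta>)\<^sup>2 = ?I 3 - ?I 2"
    by (simp only: r right_diff_distrib mult_1_right)
  then have "(rho \<eta>)\<^sup>2 * (?I 3 + ?I 2 / 2) = 3 / 2 * ?I 2"
    by (simp only: mult.commute[of "(rho \<eta>)\<^sup>2"])
  then show "(rho \<eta>)\<^sup>2 *\<^sub>R ?C 3 = (3 / 2 * ?I 2) *\<^sub>R \<eta>"
    by (simp add: 3)
qed

lemma light_integral_one_nonneg:
  assumes \<eta>: "\<eta> \<in> ball 0 1"
  shows "light_integral k (\<lambda>_. 1 :: real) (affine_lift \<eta>) \<ge> 0"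
proof -
  have "inverse (- mink (affine_lift \<eta>) (light t)) ^ k *\<^sub>R (1 :: real) \<ge> 0" for t
    using future_cone_light[OF affine_lift_future_cone[OF \<eta>], of t] by (simp del: inverse_minus_eq)
  then show ?thesis
    unfolding light_integral_def
    by (intro integral_nonneg light_integral_integrable affine_lift_future_cone \<eta> continuous_intros)
qed

text \<open>Let \<open>I(\<tau>)\<close> be the integral with exponent 1 at \<open>\<tau> \<eta>\<close>. By the relations above
  \<open>I' = \<tau> \<bar>\<eta>\<bar>\<^sup>2 I / (1 - \<tau>\<^sup>2 \<bar>\<eta>\<bar>\<^sup>2)\<close>, so \<open>I\<^sup>2 (1 - \<tau>\<^sup>2 \<bar>\<eta>\<bar>\<^sup>2)\<close> is constant on \<open>[0, 1]\<close>, and at the centre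
  of the disk it is \<open>(2\<pi>)\<^sup>2\<close>.\<close>

lemma light_integral_2_one:
  assumes \<eta>: "\<eta> \<in> ball 0 1"
  shows "(rho \<eta>) ^ 3 * light_integral 2 (\<lambda>_. 1) (affine_lift \<eta>) = 2 * pi"
proof -
  define q where "q = affine_lift \<eta> - affine_lift 0"
  have segment: "affine_lift (\<tau> *\<^sub>R \<eta>) = affine_lift 0 + \<tau> *\<^sub>R q" for \<tau>
    by (simp add: q_def affine_lift_def vec_eq_iff forall_3)
  have ball: "\<tau> *\<^sub>R \<eta> \<in> ball 0 1" if "\<tau> \<in> {0..1}" for \<tau>
    using \<eta> that mult_left_le_one_le[of "norm \<eta>" \<tau>] by auto
  let ?I = "\<lambda>k \<tau>. light_integral k (\<lambda>_. 1 :: real) (affine_lift (\<tau> *\<^sub>R \<eta>))"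
  have dI: "(?I 1 has_real_derivative \<tau> * (norm \<eta>)\<^sup>2 * ?I 2 \<tau>) (at \<tau> within {0..1})"
    if \<tau>: "\<tau> \<in> {0..1}" for \<tau>
  proof -
    note c = affine_lift_future_cone[OF ball[OF \<tau>]]
    have "((\<lambda>\<tau>. affine_lift (\<tau> *\<^sub>R \<eta>)) has_derivative (\<lambda>h. h *\<^sub>R q)) (at \<tau> within {0..1})"
      unfolding segment by (auto intro!: derivative_eq_intros)
    moreover have "(light_integral 1 (\<lambda>_. 1 :: real) has_derivative
        (\<lambda>w. light_integral 2 (\<lambda>t. mink w (light t)) (affine_lift (\<tau> *\<^sub>R \<eta>)))) (at (affine_lift (\<tau> *\<^sub>R \<eta>)))"
      using light_integral_has_derivative[OF _ c, of "\<lambda>_. 1 :: real" 1] by (simp add: numeral_2_eq_2)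
    ultimately have "((\<lambda>\<tau>. ?I 1 \<tau>) has_derivative
        (\<lambda>h. light_integral 2 (\<lambda>t. mink (h *\<^sub>R q) (light t)) (affine_lift (\<tau> *\<^sub>R \<eta>)))) (at \<tau> within {0..1})"
      by (rule has_derivative_compose)
    moreover have "light_integral 2 (\<lambda>t. mink (h *\<^sub>R q) (light t)) (affine_lift (\<tau> *\<^sub>R \<eta>)) =
        \<tau> * (norm \<eta>)\<^sup>2 * ?I 2 \<tau> * h" for h
    proof -
      have "light_integral 2 (\<lambda>t. mink (h *\<^sub>R q) (light t)) (affine_lift (\<tau> *\<^sub>R \<eta>))
          = light_integral 2 (\<lambda>t. (h *\<^sub>R \<eta>) \<bullet> unit_point t) (affine_lift (\<tau> *\<^sub>R \<eta>))"
        by (simp add: mink_simps q_def mink_affine_lift_light)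
      also have "\<dots> = (h *\<^sub>R \<eta>) \<bullet> light_integral 2 unit_point (affine_lift (\<tau> *\<^sub>R \<eta>))"
        by (intro light_integral_linear[symmetric] bounded_linear_inner_right c continuous_intros)
      also have "\<dots> = \<tau> * (norm \<eta>)\<^sup>2 * ?I 2 \<tau> * h"
        by (simp add: light_integral_one_relations(1)[OF ball[OF \<tau>]] dot_square_norm)
      finally show ?thesis .
    qed
    ultimately show ?thesis
      by (simp add: has_field_derivative_def)
  qed
  have "((\<lambda>\<tau>. (?I 1 \<tau>)\<^sup>2 * (1 - \<tau>\<^sup>2 * (norm \<eta>)\<^sup>2)) has_real_derivative 0) (at \<tau> within {0..1})"
    if \<tau>: "\<tau> \<in> {0..1}" for \<tau>
  proof -
    have "?I 1 \<tau> = (1 - \<tau>\<^sup>2 * (norm \<eta>)\<^sup>2) * ?I 2 \<tau>"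
      using light_integral_one_relations(2)[OF ball[OF \<tau>]] rho_sq[OF ball[OF \<tau>]]
      by (simp add: power_mult_distrib)
    moreover have "(of_nat 2 * (d * y * x ^ (2 - Suc 0))) * w + - (2 * d) * x\<^sup>2 = 0"
      if "x = w * y" for x y w d :: real
      unfolding that by (simp add: power2_eq_square)
    ultimately have K: "(of_nat 2 * (\<tau> * (norm \<eta>)\<^sup>2 * ?I 2 \<tau> * ?I 1 \<tau> ^ (2 - Suc 0))) * (1 - \<tau>\<^sup>2 * (norm \<eta>)\<^sup>2)
        + - (2 * (\<tau> * (norm \<eta>)\<^sup>2)) * (?I 1 \<tau>)\<^sup>2 = 0"
      by blast
    have D: "((\<lambda>\<tau>. 1 - \<tau>\<^sup>2 * (norm \<eta>)\<^sup>2) has_real_derivative - (2 * (\<tau> * (norm \<eta>)\<^sup>2))) (at \<tau> within {0..1})"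
      by (auto intro!: derivative_eq_intros)
    show ?thesis
      by (rule DERIV_cong[OF DERIV_mult[OF DERIV_power[OF dI[OF \<tau>], of 2] D] K])
  qed
  from has_field_derivative_zero_constant[OF convex_real_interval(5) this]
  obtain c where c: "\<And>\<tau>. \<tau> \<in> {0..1} \<Longrightarrow> (?I 1 \<tau>)\<^sup>2 * (1 - \<tau>\<^sup>2 * (norm \<eta>)\<^sup>2) = c"
    by blast
  have "?I 1 0 = 2 * pi"
    by (simp add: light_integral_def mink_affine_lift_light)
  then have "(?I 1 1)\<^sup>2 * (rho \<eta>)\<^sup>2 = (2 * pi)\<^sup>2"
    using c[of 0] c[of 1] rho_sq[OF \<eta>] by simp
  then have "(?I 1 1 * rho \<eta>)\<^sup>2 = (2 * pi)\<^sup>2" by (simp add: power_mult_distrib)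
  then have "?I 1 1 * rho \<eta> = 2 * pi"
    by (rule power2_eq_imp_eq) (use light_integral_one_nonneg[OF \<eta>, of 1] rho_pos[OF \<eta>] in simp_all)
  then show ?thesis
    using light_integral_one_relations(2)[OF \<eta>] by (simp add: power3_eq_cube power2_eq_square mult_ac)
qed

text \<open>The constant density \<open>\<phi> = 1\<close> gives the rotation field exactly, since then \<open>u\<close> is the coordinate
  \<open>x\<^sub>0\<close>. This normalisation identifies the boundary values.\<close>

lemma light_integral_boundary_kernel:
  assumes \<eta>: "\<eta> \<in> ball 0 1"
  shows "light_integral 3 (boundary_kernel \<eta>) (affine_lift \<eta>) = pi *\<^sub>R quarter_turn \<eta>"
proof -
  note c = affine_lift_future_cone[OF \<eta>]
  let ?k = "\<lambda>t. (rho \<eta>)\<^sup>2 *\<^sub>R unit_point t + mink (affine_lift \<eta>) (light t) *\<^sub>R \<eta>"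
  have l: "bounded_linear (\<lambda>v. (rho \<eta>) ^ 3 *\<^sub>R quarter_turn v)"
    by (intro bounded_linear_compose[OF bounded_linear_scaleR_right bounded_linear_quarter_turn])
  have "light_integral 3 ?k (affine_lift \<eta>) = light_integral 3 (\<lambda>t. (rho \<eta>)\<^sup>2 *\<^sub>R unit_point t) (affine_lift \<eta>)
      + light_integral 3 (\<lambda>t. mink (affine_lift \<eta>) (light t) *\<^sub>R \<eta>) (affine_lift \<eta>)"
    by (intro light_integral_add continuous_intros c)
  also have "light_integral 3 (\<lambda>t. (rho \<eta>)\<^sup>2 *\<^sub>R unit_point t) (affine_lift \<eta>) = (rho \<eta>)\<^sup>2 *\<^sub>R light_integral 3 unit_point (affine_lift \<eta>)"
    by (intro light_integral_linear[symmetric] bounded_linear_scaleR_right c continuous_intros)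
  also have "light_integral 3 (\<lambda>t. mink (affine_lift \<eta>) (light t) *\<^sub>R \<eta>) (affine_lift \<eta>) = - light_integral 2 (\<lambda>_. \<eta>) (affine_lift \<eta>)"
    using light_integral_Suc_mink[OF c, where k = 2 and \<psi> = "\<lambda>_. \<eta>"] by simp
  also have "light_integral 2 (\<lambda>_. \<eta>) (affine_lift \<eta>) = light_integral 2 (\<lambda>_. 1) (affine_lift \<eta>) *\<^sub>R \<eta>"
    using light_integral_linear[OF bounded_linear_scaleR_left[of \<eta>] _ c, where k = 2 and \<psi> = "\<lambda>_. 1"] by simp
  finally have "light_integral 3 ?k (affine_lift \<eta>) = (1 / 2 * light_integral 2 (\<lambda>_. 1) (affine_lift \<eta>)) *\<^sub>R \<eta>"
    by (simp add: light_integral_one_relations(3)[OF \<eta>] scaleR_left_diff_distrib[symmetric])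
  moreover have "light_integral 3 (boundary_kernel \<eta>) (affine_lift \<eta>) = (rho \<eta>) ^ 3 *\<^sub>R quarter_turn (light_integral 3 ?k (affine_lift \<eta>))"
    unfolding boundary_kernel_def[abs_def]
    by (intro light_integral_linear[OF l, symmetric] c continuous_intros)
  ultimately show ?thesis
    using light_integral_2_one[OF \<eta>] by (simp add: linear_cmul[OF linear_quarter_turn])
qed

section \<open>Continuous extension to the circle\<close>

text \<open>With \<open>s = 1 - \<langle>\<eta>, e\<rangle>\<close>, both \<open>(rho \<eta>)\<^sup>2 = (1 - \<bar>\<eta>\<bar>) (1 + \<bar>\<eta>\<bar>)\<close> and \<open>s \<bar>\<eta>\<bar>\<close> are bounded by multiples
  of \<open>s\<close>. One factor \<open>s\<close> is thereby gained, and the vector-valued kernel is dominated by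
  \<open>3 (rho \<eta>)\<^sup>3 s\<^sup>-\<^sup>2\<close>, a positive kernel of known mass.\<close>

lemma norm_boundary_kernel_le:
  assumes \<eta>: "\<eta> \<in> ball 0 1"
  shows "norm (boundary_kernel \<eta> t) \<le> 3 * (rho \<eta>) ^ 3 * (1 - \<eta> \<bullet> unit_point t)"
proof -
  define s where "s = 1 - \<eta> \<bullet> unit_point t"
  have r: "norm \<eta> < 1" "1 - norm \<eta> \<le> s"
    using \<eta> one_minus_inner_unit_point_ge[of \<eta> t] by (auto simp: s_def)
  have "(rho \<eta>)\<^sup>2 = (1 - norm \<eta>) * (1 + norm \<eta>)"
    unfolding rho_sq[OF \<eta>] by (simp add: power2_eq_square algebra_simps)
  also have "\<dots> \<le> s * 2"
    using r by (intro mult_mono) auto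
  finally have "(rho \<eta>)\<^sup>2 \<le> 2 * s" by simp
  moreover have "s * norm \<eta> \<le> s" using r by (simp add: mult_left_le)
  moreover have "norm ((rho \<eta>)\<^sup>2 *\<^sub>R unit_point t + (- s) *\<^sub>R \<eta>) \<le> (rho \<eta>)\<^sup>2 + s * norm \<eta>"
    using norm_triangle_ineq[of "(rho \<eta>)\<^sup>2 *\<^sub>R unit_point t" "(- s) *\<^sub>R \<eta>"] r by simp
  ultimately have "norm ((rho \<eta>)\<^sup>2 *\<^sub>R unit_point t + (- s) *\<^sub>R \<eta>) \<le> 3 * s" by linarith
  then have "(rho \<eta>) ^ 3 * norm ((rho \<eta>)\<^sup>2 *\<^sub>R unit_point t + (- s) *\<^sub>R \<eta>) \<le> (rho \<eta>) ^ 3 * (3 * s)"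
    using rho_pos[OF \<eta>] by (intro mult_left_mono) auto
  then show ?thesis
    using rho_pos[OF \<eta>] by (simp add: boundary_kernel_def mink_affine_lift_light norm_quarter_turn s_def mult_ac)
qed

text \<open>The usual estimate for an approximate identity. Subtracting the exact field of the constant density
  \<open>c\<close> leaves the density \<open>\<phi> - c\<close>. Near \<open>z\<close> this density is at most \<open>\<epsilon>\<close>, and the dominating kernel
  has total mass \<open>6\<pi>\<close>; away from \<open>z\<close> one has \<open>1 - \<langle>\<eta>, e\<rangle> \<ge> \<delta>\<^sup>2 / 4\<close>, and the kernel is small because
  of the factor \<open>(rho \<eta>)\<^sup>3\<close>.\<close>

lemma Klein_push_poisson_field_bound:
  assumes \<phi>: "continuous_on {0..2 * pi} \<phi>" and \<eta>: "\<eta> \<in> ball 0 1"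
    and M: "\<And>t. \<bar>\<phi> t - c\<bar> \<le> M"
    and near: "\<And>t. dist (unit_point t) z < \<delta> \<Longrightarrow> \<bar>\<phi> t - c\<bar> \<le> \<epsilon>"
    and z: "norm z = 1" and \<delta>: "\<delta> > 0" "dist \<eta> z \<le> \<delta>\<^sup>2 / 4" and \<epsilon>: "\<epsilon> \<ge> 0"
  shows "norm (Klein_push (poisson_field \<phi>) \<eta> - c *\<^sub>R quarter_turn \<eta>) \<le> 6 * \<epsilon> + 96 * M / \<delta> ^ 4 * (rho \<eta>) ^ 3"
proof -
  note cone = affine_lift_future_cone[OF \<eta>]
  note ck = continuous_on_boundary_kernel
  define s where "s t = 1 - \<eta> \<bullet> unit_point t" for t
  have s: "s t > 0" for t
    using future_cone_light[OF cone, of t] by (simp add: s_def mink_affine_lift_light)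
  have M0: "M \<ge> 0" using M[of 0] by linarith
  have P: "light_integral k \<psi> (affine_lift \<eta>) = integral {0..2 * pi} (\<lambda>t. inverse (s t) ^ k *\<^sub>R \<psi> t)" for k
    and \<psi> :: "real \<Rightarrow> 'b::banach"
    by (simp add: light_integral_def s_def mink_affine_lift_light)
  have int: "(\<lambda>t. inverse (s t) ^ k *\<^sub>R \<psi> t) integrable_on {0..2 * pi}"
    if "continuous_on {0..2 * pi} \<psi>" for k and \<psi> :: "real \<Rightarrow> 'b::banach"
    using light_integral_integrable[OF that cone, of k] by (simp add: s_def mink_affine_lift_light)
  have "light_integral 3 (\<lambda>t. \<phi> t *\<^sub>R boundary_kernel \<eta> t) (affine_lift \<eta>) =
      light_integral 3 (\<lambda>t. (\<phi> t - c) *\<^sub>R boundary_kernel \<eta> t + c *\<^sub>R boundary_kernel \<eta> t) (affine_lift \<eta>)"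
    by (simp add: algebra_simps)
  also have "\<dots> = light_integral 3 (\<lambda>t. (\<phi> t - c) *\<^sub>R boundary_kernel \<eta> t) (affine_lift \<eta>)
      + c *\<^sub>R light_integral 3 (boundary_kernel \<eta>) (affine_lift \<eta>)"
    by (subst light_integral_add)
      (auto intro!: continuous_intros \<phi> ck cone
        simp: light_integral_linear[OF bounded_linear_scaleR_right ck cone, symmetric])
  finally have "Klein_push (poisson_field \<phi>) \<eta> - c *\<^sub>R quarter_turn \<eta> =
      (1 / pi) *\<^sub>R light_integral 3 (\<lambda>t. (\<phi> t - c) *\<^sub>R boundary_kernel \<eta> t) (affine_lift \<eta>)"
    by (simp add: Klein_push_poisson_field[OF \<phi> \<eta>] light_integral_boundary_kernel[OF \<eta>] scaleR_add_right)
  moreover have "norm (light_integral 3 (\<lambda>t. (\<phi> t - c) *\<^sub>R boundary_kernel \<eta> t) (affine_lift \<eta>))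
      \<le> integral {0..2 * pi} (\<lambda>t. inverse (s t) ^ 2 *\<^sub>R (3 * (rho \<eta>) ^ 3 * \<epsilon>) + 3 * (rho \<eta>) ^ 3 * (16 * M / \<delta> ^ 4))"
    unfolding P
  proof (rule integral_norm_bound_integral)
    show "(\<lambda>t. inverse (s t) ^ 3 *\<^sub>R (\<phi> t - c) *\<^sub>R boundary_kernel \<eta> t) integrable_on {0..2 * pi}"
      by (intro int continuous_intros \<phi> ck)
    show "(\<lambda>t. inverse (s t) ^ 2 *\<^sub>R (3 * (rho \<eta>) ^ 3 * \<epsilon>) + 3 * (rho \<eta>) ^ 3 * (16 * M / \<delta> ^ 4))
        integrable_on {0..2 * pi}"
      by (intro integrable_add int integrable_const_ivl continuous_intros)
    fix t
    \<comment> \<open>The sum of the bounds for the two cases holds in both, which avoids splitting the integral.\<close>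
    have *: "inverse (s t) ^ 2 * \<bar>\<phi> t - c\<bar> \<le> inverse (s t) ^ 2 * \<epsilon> + 16 * M / \<delta> ^ 4"
    proof (cases "dist (unit_point t) z < \<delta>")
      case True
      have "inverse (s t) ^ 2 * \<bar>\<phi> t - c\<bar> \<le> inverse (s t) ^ 2 * \<epsilon>"
        using near[OF True] by (intro mult_left_mono) auto
      moreover have "16 * M / \<delta> ^ 4 \<ge> 0" using M0 by simp
      ultimately show ?thesis by linarith
    next
      case False
      have "(dist (unit_point t) z)\<^sup>2 = 2 - 2 * (z \<bullet> unit_point t)"
        using z dot_norm_neg[of z "unit_point t"] by (simp add: dist_commute dist_norm)
      moreover have "\<delta>\<^sup>2 \<le> (dist (unit_point t) z)\<^sup>2"
        using False \<delta>(1) by (intro power_mono) auto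
      moreover have "(\<eta> - z) \<bullet> unit_point t \<le> \<delta>\<^sup>2 / 4"
        using norm_cauchy_schwarz[of "\<eta> - z" "unit_point t"] \<delta>(2) by (simp add: dist_norm)
      ultimately have "\<delta>\<^sup>2 / 4 \<le> s t"
        by (simp add: s_def inner_diff_left)
      then have "inverse (s t) \<le> inverse (\<delta>\<^sup>2 / 4)"
        using \<delta>(1) by (intro le_imp_inverse_le) auto
      then have "inverse (s t) ^ 2 \<le> inverse (\<delta>\<^sup>2 / 4) ^ 2"
        using s[of t] by (intro power_mono) auto
      also have "\<dots> = 16 / \<delta> ^ 4"
        using \<delta>(1) by (simp add: field_simps power2_eq_square power4_eq_xxxx)
      finally have "inverse (s t) ^ 2 * \<bar>\<phi> t - c\<bar> \<le> 16 / \<delta> ^ 4 * M"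
        using M[of t] \<delta>(1) by (intro mult_mono) auto
      moreover have "inverse (s t) ^ 2 * \<epsilon> \<ge> 0" using \<epsilon> by simp
      ultimately show ?thesis by simp
    qed
    have "norm (inverse (s t) ^ 3 *\<^sub>R (\<phi> t - c) *\<^sub>R boundary_kernel \<eta> t)
        = inverse (s t) ^ 3 * \<bar>\<phi> t - c\<bar> * norm (boundary_kernel \<eta> t)"
      using s[of t] by (simp add: abs_mult power_abs)
    also have "\<dots> \<le> inverse (s t) ^ 3 * \<bar>\<phi> t - c\<bar> * (3 * (rho \<eta>) ^ 3 * s t)"
      using norm_boundary_kernel_le[OF \<eta>, of t] s[of t] by (intro mult_left_mono) (auto simp: s_def)
    also have "\<dots> = 3 * (rho \<eta>) ^ 3 * (inverse (s t) ^ 2 * \<bar>\<phi> t - c\<bar>)"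
      using s[of t] by (simp add: field_simps power3_eq_cube power2_eq_square)
    also have "\<dots> \<le> 3 * (rho \<eta>) ^ 3 * (inverse (s t) ^ 2 * \<epsilon> + 16 * M / \<delta> ^ 4)"
      using rho_pos[OF \<eta>] * by (intro mult_left_mono) auto
    finally show "norm (inverse (s t) ^ 3 *\<^sub>R (\<phi> t - c) *\<^sub>R boundary_kernel \<eta> t)
        \<le> inverse (s t) ^ 2 *\<^sub>R (3 * (rho \<eta>) ^ 3 * \<epsilon>) + 3 * (rho \<eta>) ^ 3 * (16 * M / \<delta> ^ 4)"
      by (simp add: algebra_simps)
  qed
  moreover have "integral {0..2 * pi} (\<lambda>t. inverse (s t) ^ 2 *\<^sub>R (3 * (rho \<eta>) ^ 3 * \<epsilon>) + 3 * (rho \<eta>) ^ 3 * (16 * M / \<delta> ^ 4))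
      = light_integral 2 (\<lambda>_. 3 * (rho \<eta>) ^ 3 * \<epsilon>) (affine_lift \<eta>) + 2 * pi * (3 * (rho \<eta>) ^ 3 * (16 * M / \<delta> ^ 4))"
    unfolding P
    by (subst integral_add[OF int[OF continuous_on_const]]) (simp_all add: integrable_const_ivl)
  moreover have "light_integral 2 (\<lambda>_. 3 * (rho \<eta>) ^ 3 * \<epsilon>) (affine_lift \<eta>) = 3 * \<epsilon> * (2 * pi)"
    using light_integral_linear[OF bounded_linear_mult_left[of "3 * (rho \<eta>) ^ 3 * \<epsilon>"] _ cone, where k = 2 and \<psi> = "\<lambda>_. 1"]
    unfolding light_integral_2_one[OF \<eta>, symmetric] by (simp add: mult_ac)
  ultimately have "norm (Klein_push (poisson_field \<phi>) \<eta> - c *\<^sub>R quarter_turn \<eta>) \<le>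
      (1 / pi) * (3 * \<epsilon> * (2 * pi) + 2 * pi * (3 * (rho \<eta>) ^ 3 * (16 * M / \<delta> ^ 4)))"
    by (simp add: divide_right_mono)
  also have "\<dots> = 6 * \<epsilon> + 96 * M / \<delta> ^ 4 * (rho \<eta>) ^ 3"
    by (simp add: field_simps)
  finally show ?thesis .
qed

lemma extends_continuously_poisson_field:
  assumes f: "continuous_on (sphere 0 1) f"
  shows "extends_continuously_to (poisson_field (\<lambda>t. f (unit_point t))) (\<lambda>z. f z *\<^sub>R quarter_turn z)"
  unfolding extends_continuously_to_def
proof (intro allI impI)
  fix \<eta> :: "nat \<Rightarrow> real^2" and z
  assume \<eta>: "\<forall>n. \<eta> n \<in> ball 0 1" and z: "z \<in> sphere 0 1" and lim: "\<eta> \<longlonglongrightarrow> z"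
  let ?\<phi> = "\<lambda>t. f (unit_point t)"
  have \<phi>: "continuous_on {0..2 * pi} ?\<phi>"
    by (rule continuous_on_compose2[OF f continuous_on_unit_point]) auto
  have nz: "norm z = 1" using z by simp
  have "bounded (f ` sphere 0 1)"
    by (rule compact_imp_bounded[OF compact_continuous_image[OF f compact_sphere]])
  then obtain B where "\<forall>y\<in>f ` sphere 0 1. norm y \<le> B"
    unfolding bounded_iff by blast
  then have B: "\<bar>f w\<bar> \<le> B" if "w \<in> sphere 0 1" for w
    using that by auto
  define M where "M = 2 * B"
  have M: "\<bar>f (unit_point t) - f z\<bar> \<le> M" for t
    using B[of "unit_point t"] B[of z] z by (simp add: M_def)
  have rho0: "(\<lambda>n. rho (\<eta> n)) \<longlonglongrightarrow> 0"
  proof -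
    have "(\<lambda>n. rho (\<eta> n)) \<longlonglongrightarrow> sqrt (1 - (norm z)\<^sup>2)"
      unfolding rho_def by (intro tendsto_intros lim)
    then show ?thesis using nz by simp
  qed
  have "(\<lambda>n. Klein_push (poisson_field ?\<phi>) (\<eta> n) - f z *\<^sub>R quarter_turn (\<eta> n)) \<longlonglongrightarrow> 0"
  proof (rule tendstoI)
    fix e :: real assume e: "e > 0"
    obtain \<delta> where \<delta>: "\<delta> > 0" "\<And>w. w \<in> sphere 0 1 \<Longrightarrow> dist w z < \<delta> \<Longrightarrow> dist (f w) (f z) < e / 12"
      using f z e unfolding continuous_on_iff by (metis divide_pos_pos zero_less_numeral)
    have near: "\<bar>f (unit_point t) - f z\<bar> \<le> e / 12" if "dist (unit_point t) z < \<delta>" for t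
      using \<delta>(2)[of "unit_point t"] that by (simp add: dist_real_def)
    have "(\<lambda>n. 96 * M / \<delta> ^ 4 * (rho (\<eta> n)) ^ 3) \<longlonglongrightarrow> 96 * M / \<delta> ^ 4 * 0 ^ 3"
      by (intro tendsto_intros rho0)
    then have "eventually (\<lambda>n. 96 * M / \<delta> ^ 4 * (rho (\<eta> n)) ^ 3 < e / 2) sequentially"
      using e by (intro order_tendstoD(2)[where y = "96 * M / \<delta> ^ 4 * 0 ^ 3"]) auto
    moreover have "eventually (\<lambda>n. dist (\<eta> n) z < \<delta>\<^sup>2 / 4) sequentially"
      using \<delta>(1) by (intro tendstoD[OF lim]) simp
    ultimately show "eventually (\<lambda>n. dist (Klein_push (poisson_field ?\<phi>) (\<eta> n) - f z *\<^sub>R quarter_turn (\<eta> n)) 0 < e) sequentially"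
    proof eventually_elim
      case (elim n)
      from Klein_push_poisson_field_bound[OF \<phi> \<eta>[rule_format] M near nz \<delta>(1) less_imp_le[OF elim(2)]] e
      have "norm (Klein_push (poisson_field ?\<phi>) (\<eta> n) - f z *\<^sub>R quarter_turn (\<eta> n)) \<le> 6 * (e / 12) + 96 * M / \<delta> ^ 4 * (rho (\<eta> n)) ^ 3"
        by simp
      then show ?case using elim(1) by simp
    qed
  qed
  moreover have "(\<lambda>n. f z *\<^sub>R quarter_turn (\<eta> n)) \<longlonglongrightarrow> f z *\<^sub>R quarter_turn z"
    by (intro tendsto_intros bounded_linear.tendsto[OF bounded_linear_quarter_turn] lim)
  ultimately have "(\<lambda>n. (Klein_push (poisson_field ?\<phi>) (\<eta> n) - f z *\<^sub>R quarter_turn (\<eta> n)) + f z *\<^sub>R quarter_turn (\<eta> n))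
      \<longlonglongrightarrow> 0 + f z *\<^sub>R quarter_turn z"
    by (rule tendsto_add)
  then show "(\<lambda>n. Klein_push (poisson_field ?\<phi>) (\<eta> n)) \<longlonglongrightarrow> f z *\<^sub>R quarter_turn z"
    by simp
qed

theorem theorem1p4:
  fixes X :: "real^2 \<Rightarrow> real^2"
  assumes "continuous_circle_field X"
  shows "\<exists>V :: real^3 \<Rightarrow> real^3. harmonic_lagrangian V \<and> extends_continuously_to V X"
proof -
  define f where "f z = X z \<bullet> quarter_turn z" for z
  have X: "continuous_on (sphere 0 1) X" "\<And>z. z \<in> sphere 0 1 \<Longrightarrow> X z \<bullet> z = 0"
    using assms by (auto simp: continuous_circle_field_def)
  have f: "continuous_on (sphere 0 1) f"
    unfolding f_def by (intro continuous_intros X)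
  \<comment> \<open>On the circle \<open>z\<close> and \<open>quarter_turn z\<close> form an orthonormal basis.\<close>
  have "X z = f z *\<^sub>R quarter_turn z" if "z \<in> sphere 0 1" for z
  proof -
    have "(z $ 1)\<^sup>2 + (z $ 2)\<^sup>2 = 1" using that norm_2_sq[of z] by simp
    moreover have "X z $ 1 * z $ 1 + X z $ 2 * z $ 2 = 0"
      using X(2)[OF that] by (simp add: inner_2)
    ultimately have "X z $ 1 = (- (X z $ 1 * z $ 2) + X z $ 2 * z $ 1) * - z $ 2"
      "X z $ 2 = (- (X z $ 1 * z $ 2) + X z $ 2 * z $ 1) * z $ 1"
      by algebra+
    then show ?thesis by (simp add: f_def quarter_turn_def inner_2 vec_eq_iff forall_2)
  qed
  then have "extends_continuously_to (poisson_field (\<lambda>t. f (unit_point t))) X"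
    using extends_continuously_poisson_field[OF f] by (simp add: extends_continuously_to_def)
  moreover have "continuous_on {0..2 * pi} (\<lambda>t. f (unit_point t))"
    by (rule continuous_on_compose2[OF f continuous_on_unit_point]) auto
  ultimately show ?thesis
    using harmonic_lagrangian_poisson_field by blast
qed

end
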